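(* Let $n$ be a positive integer that is not a power of $2$ and let $x\in\mathsf S_n$ be a $2$-element. Assume that the lengths of the cycles in $x$ (fixed points being counted as cycles of length $1$) are $2^{m_i}$, $1\le i\le r$, for integers $0\le m_1<m_2<\cdots<m_r$, and that $x$ possesses exactly $\ell_i\ge1$ cycles of length $2^{m_i}$ for every $1\le i\le r$. Then $\mathbf{Sub}_{\mathsf S_n}(x)<\mathsf S_n$ (proper subgroup) if and only if there exists $t\ge 2$ (with $t\le r$) such that $2^{m_t}>\sum_{i=1}^{t-1}\ell_i2^{m_i}$. Moreover, in such a case $$\mathbf{Sub}_{\mathsf S_n}(x)=\mathbf{Sub}_{\mathsf S_k}(y)\times\mathbf{Sub}_{\mathsf S_{n-k}}(z),$$ where $k=\ell_r2^{m_r}+\cdots+\ell_t2^{m_t}$, $y$ is the product of all cycles of $x$ of length at least $2^{m_t}$, and $z$ is the product of all cycles of $x$ of length smaller than $2^{m_t}$.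
   Context: $\mathsf S_n$ is the symmetric group on $\{1,\dots,n\}$. A $2$-element is an element of $2$-power order. The subnormalizer of $x$ in a finite group $G$ is $\mathbf{Sub}_G(x)=\langle g\in G\mid\langle x\rangle\text{ is subnormal in }\langle x,g\rangle\rangle$. Here $y$ is viewed as an element of $\mathrm{Sym}(\Omega)\cong\mathsf S_k$, where $\Omega$ (of size $k$) is the union of the supports of the cycles of $x$ of length at least $2^{m_t}$, and $z$ is viewed as an element of $\mathrm{Sym}(\{1,\dots,n\}\setminus\Omega)\cong\mathsf S_{n-k}$; the direct product is taken inside $\mathrm{Sym}(\Omega)\times\mathrm{Sym}(\{1,\dots,n\}\setminus\Omega)\le\mathsf S_n$. *)

theory Defs
  imports "HOL-Algebra.Sym_Groups" "HOL-Algebra.Multiplicative_Group" "HOL-Combinatorics.Orbits"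
begin

inductive subnormal :: "('a, 'b) monoid_scheme \<Rightarrow> 'a set \<Rightarrow> 'a set \<Rightarrow> bool"
  for G where
  refl: "subgroup K G \<Longrightarrow> subnormal G K K"
| step: "subnormal G L K \<Longrightarrow> H \<lhd> G\<lparr>carrier := L\<rparr> \<Longrightarrow> subnormal G H K"

definition subnormalizer :: "('a, 'b) monoid_scheme \<Rightarrow> 'a \<Rightarrow> 'a set" where
  "subnormalizer G x =
     generate G {g \<in> carrier G. subnormal G (generate G {x}) (generate G {x, g})}"

lemma subnormalizer_is_subgroup:
  assumes "group G"
  shows "subgroup (subnormalizer G x) G"
  unfolding subnormalizer_def by (rule group.generate_is_subgroup[OF assms]) auto

definition sym_group_on :: "'a set \<Rightarrow> ('a \<Rightarrow> 'a) monoid" where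
  "sym_group_on A = \<lparr>carrier = {p. p permutes A}, monoid.mult = (\<circ>), one = id\<rparr>"

lemma sym_group_on_atLeastAtMost: "sym_group_on {1..n} = sym_group n"
  by (simp add: sym_group_on_def sym_group_def)

(* A cycle of x is represented by its support; a fixed point a of x in A
   contributes the cycle {a} of length 1. *)
definition cycles_on :: "('a \<Rightarrow> 'a) \<Rightarrow> 'a set \<Rightarrow> 'a set set" where
  "cycles_on x A = orbit x ` A"

(* The cycle of x with support C is perm_restrict x C.  Distinct cycles commute, so the
   fold does not depend on the order of the factors; see cycle_product_eq. *)
definition cycle_product :: "('a \<Rightarrow> 'a) \<Rightarrow> 'a set set \<Rightarrow> 'a \<Rightarrow> 'a" where
  "cycle_product x \<C> = Finite_Set.fold (\<lambda>C p. perm_restrict x C \<circ> p) id \<C>"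

lemma cycles_on_cyclic:
  assumes "x permutes A" "finite A" "C \<in> cycles_on x A"
  shows "cyclic_on x C"
  using assms permutation_permutes by (fastforce simp: cycles_on_def intro: cyclic_on_orbit)

lemma cycles_on_disjoint:
  assumes "x permutes A" "finite A" "C \<in> cycles_on x A" "D \<in> cycles_on x A" "C \<noteq> D"
  shows "C \<inter> D = {}"
  using cycles_on_cyclic[OF assms(1-3)] cycles_on_cyclic[OF assms(1,2,4)] assms(5)
  by (metis disjoint_iff orbit_cyclic_eq3)

lemma cycle_product_eq:
  assumes "x permutes A" "finite A" "\<C> \<subseteq> cycles_on x A"
  shows "cycle_product x \<C> = perm_restrict x (\<Union>\<C>)"
proof -
  interpret comp_fun_commute_on "cycles_on x A" "\<lambda>C p. perm_restrict x C \<circ> p"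
  proof
    fix C D assume C: "C \<in> cycles_on x A" and D: "D \<in> cycles_on x A"
    have "perm_restrict x D \<circ> perm_restrict x C = perm_restrict x C \<circ> perm_restrict x D"
    proof (cases "C = D")
      case False
      have "C \<inter> D = {}"
        using cycles_on_disjoint[OF assms(1,2) C D False] .
      then show ?thesis
        using perm_restrict_comp[of C D x] perm_restrict_comp[of D C x]
          cycles_on_cyclic[OF assms(1,2) C] cycles_on_cyclic[OF assms(1,2) D]
        by (simp add: Int_commute Un_commute)
    qed simp
    then show "(\<circ>) (perm_restrict x D) \<circ> (\<circ>) (perm_restrict x C) =
        (\<circ>) (perm_restrict x C) \<circ> (\<circ>) (perm_restrict x D)"
      by (simp add: fun_eq_iff)
  qed
  have "finite \<C>"
    using assms(2,3) finite_subset unfolding cycles_on_def by blast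
  then show ?thesis
    using assms(3)
  proof (induction \<C>)
    case empty
    then show ?case
      by (simp add: cycle_product_def perm_restrict_def fun_eq_iff)
  next
    case (insert C \<C>)
    have cyc: "cyclic_on x D" if "D \<in> \<C>" for D
      using that cycles_on_cyclic[OF assms(1,2)] insert.prems by auto
    have "C \<inter> D = {}" if "D \<in> \<C>" for D
      using that cycles_on_disjoint[OF assms(1,2), of C D] insert by auto
    then have "C \<inter> \<Union>\<C> = {}"
      by blast
    moreover have "x a \<in> \<Union>\<C>" if "a \<in> \<Union>\<C>" for a
      using that cyc cyclic_on_inI by fastforce
    ultimately have "perm_restrict x C \<circ> perm_restrict x (\<Union>\<C>) = perm_restrict x (C \<union> \<Union>\<C>)"
      by (auto simp: perm_restrict_def fun_eq_iff)
    moreover have "cycle_product x (insert C \<C>) = perm_restrict x C \<circ> cycle_product x \<C>"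
      using insert by (simp add: cycle_product_def)
    ultimately show ?case
      using insert by simp
  qed
qed

end

theory Submission
  imports Defs "HOL-Algebra.Sylow"
begin

text \<open>
  Subgroups of finite \<open>p\<close>-groups are subnormal, so the subnormalizer of a 2-element \<open>x\<close>
  contains every 2-subgroup containing \<open>x\<close>; conversely, if \<open>\<langle>x\<rangle>\<close> is subnormal in
  \<open>\<langle>x, g\<rangle>\<close>, then \<open>x\<close> lies in a normal 2-subgroup \<open>Q\<close> of \<open>\<langle>x, g\<rangle>\<close>.

  Suppose the cycles shorter than \<open>2^e\<close> cover fewer than \<open>2^e\<close> points. If such a \<open>g\<close>
  moved a point of a long cycle to a point \<open>q\<close> of a short one, the \<open>Q\<close>-orbit of \<open>q\<close> would have
  2-power size at least \<open>2^e\<close>; its points on long cycles number a multiple of \<open>2^e\<close>, hence so do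
  its points on short cycles, which are too few. So the subnormalizer splits along the long cycles.

  Otherwise, call two points linked if their transposition is in the subnormalizer; this is an
  equivalence relation invariant under the subnormalizer. Points on distinct cycles of equal length
  are linked. A cycle of length \<open>2^e\<close> together with shorter cycles of total size \<open>2^e\<close> carries a
  Sylow 2-subgroup containing the restriction of \<open>x\<close>, which is transitive and fixes all other
  points. By induction on \<open>e\<close>, the points on cycles shorter than \<open>2^e\<close> are all linked unless
  their number is a power of 2 that is at most \<open>2^e\<close>; as \<open>n\<close> is not a power of 2, all points
  are linked in the end.
\<close>

section \<open>Finite p-groups\<close>

text \<open>Subnormal chains live in restricted groups; this form lets later arguments compute with
  the operations and subgroups of the ambient group.\<close>

lemma (in group) normal_in_subgroup_iff:
  assumes "subgroup L G"
  shows "H \<lhd> G\<lparr>carrier := L\<rparr> \<longleftrightarrow>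
    subgroup H G \<and> H \<subseteq> L \<and> (\<forall>a\<in>L. \<forall>h\<in>H. a \<otimes> h \<otimes> inv a \<in> H)"
proof -
  have "subgroup H (G\<lparr>carrier := L\<rparr>) \<longleftrightarrow> subgroup H G \<and> H \<subseteq> L"
    using incl_subgroup[OF assms] subgroup_incl[OF _ assms] subgroup.subset by fastforce
  then show ?thesis
    using assms by (simp add: group.normal_inv_iff[OF subgroup_imp_group[OF assms]])
qed

text \<open>The fibre over \<open>act g x\<close> is the left coset of the stabilizer by
  \<open>g\<close>. The action laws are stated at \<open>x\<close> alone; \<open>act\<close> may
  come from coset multiplication or from evaluation of permutations.\<close>

lemma (in group) card_orbit_times_stabilizer:
  assumes fin: "finite (carrier G)"
    and one: "act \<one> x = x"
    and mult: "\<And>g h. g \<in> carrier G \<Longrightarrow> h \<in> carrier G \<Longrightarrow> act (g \<otimes> h) x = act g (act h x)"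
  shows "card ((\<lambda>g. act g x) ` carrier G) * card {g \<in> carrier G. act g x = x} = order G"
proof -
  define S where "S = {g \<in> carrier G. act g x = x}"
  have fibre: "card {h \<in> carrier G. act h x = y} = card S"
    if y: "y \<in> (\<lambda>g. act g x) ` carrier G" for y
  proof -
    obtain g where g: "g \<in> carrier G" "y = act g x"
      using y by blast
    have "(\<otimes>) g ` S = {h \<in> carrier G. act h x = y}"
    proof safe
      fix s assume "s \<in> S"
      then show "g \<otimes> s \<in> carrier G" "act (g \<otimes> s) x = y"
        using g mult by (auto simp: S_def)
    next
      fix h assume h: "h \<in> carrier G" "y = act h x"
      have "act (inv g \<otimes> h) x = act (inv g) (act g x)"
        using g h mult by simp
      also have "\<dots> = x"
        using g mult[of "inv g" g] one by simp
      finally have "inv g \<otimes> h \<in> S"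
        using g h by (simp add: S_def)
      moreover have "h = g \<otimes> (inv g \<otimes> h)"
        using g h by (simp add: m_assoc[symmetric])
      ultimately show "h \<in> (\<otimes>) g ` S"
        by blast
    qed
    moreover have "inj_on ((\<otimes>) g) S"
      using g by (intro inj_onI) (simp add: S_def)
    ultimately show ?thesis
      using card_image by metis
  qed
  have "order G = (\<Sum>y\<in>(\<lambda>g. act g x) ` carrier G. \<Sum>h\<in>{h \<in> carrier G. act h x = y}. 1)"
    unfolding order_def card_eq_sum using fin by (rule sum.image_gen)
  also have "\<dots> = card ((\<lambda>g. act g x) ` carrier G) * card S"
    using fibre by simp
  finally show ?thesis
    by (simp add: S_def)
qed

text \<open>The moved points form a disjoint union of orbits, each of which has size a power of
  \<open>p\<close> other than 1.\<close>

lemma (in group) prime_dvd_card_moved_points: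
  assumes fin: "finite (carrier G)" "finite X" and p: "prime p" and order: "order G = p ^ k"
    and closed: "\<And>g x. g \<in> carrier G \<Longrightarrow> x \<in> X \<Longrightarrow> act g x \<in> X"
    and one: "\<And>x. x \<in> X \<Longrightarrow> act \<one> x = x"
    and mult: "\<And>g h x. g \<in> carrier G \<Longrightarrow> h \<in> carrier G \<Longrightarrow> x \<in> X \<Longrightarrow>
      act (g \<otimes> h) x = act g (act h x)"
  shows "p dvd card {x \<in> X. \<exists>g\<in>carrier G. act g x \<noteq> x}"
proof -
  define M where "M = {x \<in> X. \<exists>g\<in>carrier G. act g x \<noteq> x}"
  define Orb where "Orb x = (\<lambda>g. act g x) ` carrier G" for x
  have self: "x \<in> Orb x" if "x \<in> X" for x
    unfolding Orb_def using one[OF that] one_closed by (metis image_eqI)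
  have eq: "Orb y = Orb x" if x: "x \<in> X" and y: "y \<in> Orb x" for x y
  proof -
    obtain g where g: "g \<in> carrier G" "y = act g x"
      using y by (auto simp: Orb_def)
    have "act h y \<in> Orb x" if "h \<in> carrier G" for h
      using g that x mult[of h g x] by (auto simp: Orb_def intro!: image_eqI[of _ _ "h \<otimes> g"])
    moreover have "act h x \<in> Orb y" if "h \<in> carrier G" for h
    proof -
      have "act (h \<otimes> inv g) y = act (h \<otimes> inv g \<otimes> g) x"
        using g that x mult[of "h \<otimes> inv g" g x] by simp
      also have "h \<otimes> inv g \<otimes> g = h"
        using g that by (simp add: m_assoc)
      finally show ?thesis
        using g that by (auto simp: Orb_def intro!: image_eqI[of _ _ "h \<otimes> inv g"])
    qed
    ultimately show ?thesis
      by (auto simp: Orb_def)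
  qed
  have dvd: "p dvd card (Orb x)" if x: "x \<in> M" for x
  proof -
    have xX: "x \<in> X"
      using x by (simp add: M_def)
    have "card (Orb x) dvd p ^ k"
      unfolding Orb_def order[symmetric]
      using card_orbit_times_stabilizer[of act x, OF fin(1) one[OF xX] mult[OF _ _ xX]]
      by (metis dvd_triv_left)
    moreover have "card (Orb x) \<noteq> 1"
    proof
      assume "card (Orb x) = 1"
      then have "Orb x = {x}"
        using self[OF xX] by (metis card_1_singletonE singletonD)
      then show False
        using x by (auto simp: M_def Orb_def)
    qed
    ultimately show ?thesis
      using p by (metis divides_primepow_nat dvd_power power_0 neq0_conv)
  qed
  have sub: "Orb x \<subseteq> M" if x: "x \<in> M" for x
  proof
    fix y assume y: "y \<in> Orb x"
    have xX: "x \<in> X"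
      using x by (simp add: M_def)
    have yX: "y \<in> X"
      using y xX closed by (auto simp: Orb_def)
    show "y \<in> M"
    proof (rule ccontr)
      assume "y \<notin> M"
      then have "Orb y \<subseteq> {y}"
        using yX by (auto simp: M_def Orb_def)
      then have "Orb x = {x}"
        using eq[OF xX y] self[OF xX] by auto
      then show False
        using x by (auto simp: M_def Orb_def)
    qed
  qed
  have M: "\<Union> (Orb ` M) = M"
    using sub self by (fastforce simp: M_def)
  have "p dvd card (\<Union> (Orb ` M))"
  proof (rule dvd_partition)
    show "finite (\<Union> (Orb ` M))"
      unfolding M using fin(2) by (simp add: M_def)
    show "\<forall>c\<in>Orb ` M. p dvd card c"
      using dvd by blast
    show "\<forall>c1\<in>Orb ` M. \<forall>c2\<in>Orb ` M. c1 \<noteq> c2 \<longrightarrow> c1 \<inter> c2 = {}"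
    proof (intro ballI impI)
      fix c1 c2 assume c: "c1 \<in> Orb ` M" "c2 \<in> Orb ` M" "c1 \<noteq> c2"
      then obtain x y where "c1 = Orb x" "x \<in> X" "c2 = Orb y" "y \<in> X"
        by (auto simp: M_def)
      then show "c1 \<inter> c2 = {}"
        using c(3) eq[of x] eq[of y] by blast
    qed
  qed
  then show ?thesis
    unfolding M by (simp add: M_def)
qed

text \<open>\<open>H\<close> acts on the right cosets of \<open>K\<close> by right multiplication.
  With \<open>K = H\<close> this finds normalizing elements; with \<open>K\<close> a Sylow subgroup
  it conjugates \<open>H\<close> into \<open>K\<close>.\<close>

lemma (in group) prime_dvd_card_moved_cosets:
  assumes fin: "finite (carrier G)" and p: "prime p"
    and H: "subgroup H G" "card H = p ^ k" and K: "subgroup K G"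
  shows "p dvd card {C \<in> rcosets K. \<exists>h\<in>H. C #> h \<noteq> C}"
proof -
  interpret H: group "G\<lparr>carrier := H\<rparr>"
    using subgroup_imp_group[OF H(1)] .
  have HG: "h \<in> carrier G" if "h \<in> H" for h
    using that H(1) subgroup.mem_carrier by fastforce
  have KG: "K \<subseteq> carrier G"
    using K subgroup.subset by blast
  have sub: "C \<subseteq> carrier G" if "C \<in> rcosets K" for C
    using that rcosets_part_G[OF K] by blast
  \<comment> \<open>Right multiplication reverses products, so the left action is multiplication by
    the inverse.\<close>
  have "p dvd card {C \<in> rcosets K. \<exists>h\<in>carrier (G\<lparr>carrier := H\<rparr>). C #> inv h \<noteq> C}"
  proof (rule H.prime_dvd_card_moved_points[where k = k])
    show "finite (carrier (G\<lparr>carrier := H\<rparr>))"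
      using fin H(1) subgroup.subset finite_subset by fastforce
    show "finite (rcosets K)"
      using fin by (simp add: RCOSETS_def)
    show "C #> inv h \<in> rcosets K"
      if h: "h \<in> carrier (G\<lparr>carrier := H\<rparr>)" and C: "C \<in> rcosets K" for h C
    proof -
      obtain a where a: "a \<in> carrier G" "C = K #> a"
        using C by (auto simp: RCOSETS_def)
      then have "C #> inv h = K #> (a \<otimes> inv h)"
        using h HG KG by (simp add: coset_mult_assoc)
      then show ?thesis
        using a h HG KG by (simp add: rcosetsI)
    qed
    show "C #> inv \<one>\<^bsub>G\<lparr>carrier := H\<rparr>\<^esub> = C" if "C \<in> rcosets K" for C
      using sub[OF that] by simp
    show "C #> inv (g \<otimes>\<^bsub>G\<lparr>carrier := H\<rparr>\<^esub> h) = C #> inv h #> inv g"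
      if "g \<in> carrier (G\<lparr>carrier := H\<rparr>)" "h \<in> carrier (G\<lparr>carrier := H\<rparr>)" "C \<in> rcosets K" for g h C
      using that sub HG by (simp add: inv_mult_group coset_mult_assoc)
  qed (use p H in \<open>simp_all add: order_def\<close>)
  moreover have "(\<exists>h\<in>H. C #> inv h \<noteq> C) \<longleftrightarrow> (\<exists>h\<in>H. C #> h \<noteq> C)" for C
    using H(1) HG by (metis inv_inv subgroup.m_inv_closed)
  ultimately show ?thesis
    by simp
qed

text \<open>Turns the counting of fixed cosets into statements about subgroups: a coset fixed by all
  of \<open>H\<close> yields an element conjugating \<open>H\<close> into \<open>K\<close>.\<close>

lemma (in group) rcoset_fixed_iff:
  assumes K: "subgroup K G" and a: "a \<in> carrier G" and h: "h \<in> carrier G"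
  shows "K #> a #> h = K #> a \<longleftrightarrow> a \<otimes> h \<otimes> inv a \<in> K"
proof -
  have "K #> a #> h = K #> a \<longleftrightarrow> K #> (a \<otimes> h) = K #> a"
    using subgroup.subset[OF K] a h by (simp add: coset_mult_assoc)
  also have "\<dots> \<longleftrightarrow> a \<otimes> h \<otimes> inv a \<in> K"
  proof
    assume "K #> (a \<otimes> h) = K #> a"
    then show "a \<otimes> h \<otimes> inv a \<in> K"
      using subgroup.rcos_module_imp[OF K is_group a] K a h
      by (metis m_closed rcos_self)
  next
    assume "a \<otimes> h \<otimes> inv a \<in> K"
    then have "a \<otimes> h \<in> K #> a"
      using subgroup.rcos_module_rev[OF K is_group a] a h by simp
    then show "K #> (a \<otimes> h) = K #> a"
      using repr_independence[OF _ a K] by simp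
  qed
  finally show ?thesis .
qed

text \<open>Let \<open>H\<close> act on its own right cosets. Their number is a power of
  \<open>p\<close> larger than 1, so \<open>p\<close> divides the number of fixed cosets. As
  \<open>H\<close> itself is fixed, there is another fixed coset, and its representative normalizes
  \<open>H\<close>.\<close>

lemma (in group) normalizer_grows:
  assumes fin: "finite (carrier G)" and p: "prime p"
    and H: "subgroup H G" "H \<noteq> carrier G" and order: "order G = p ^ k"
  obtains a where "a \<in> carrier G" "a \<notin> H" "\<And>h. h \<in> H \<Longrightarrow> a \<otimes> h \<otimes> inv a \<in> H"
proof -
  define X where "X = rcosets H"
  define M where "M = {C \<in> X. \<exists>h\<in>H. C #> h \<noteq> C}"
  have HG: "H \<subseteq> carrier G"
    using H(1) subgroup.subset by blast
  have lag: "card X * card H = p ^ k"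
    using lagrange[OF H(1)] order by (simp add: X_def)
  then obtain j where j: "card H = p ^ j"
    by (metis divides_primepow_nat dvd_triv_right p)
  have "card H < order G"
    using HG H(2) fin by (simp add: order_def psubset_card_mono psubset_eq)
  then have "card X \<noteq> 1"
    using lag order by auto
  then have "p dvd card X"
    using lag p by (metis divides_primepow_nat dvd_power dvd_triv_left power_0 neq0_conv)
  moreover have "p dvd card M"
    unfolding M_def X_def by (rule prime_dvd_card_moved_cosets[OF fin p H(1) j H(1)])
  moreover have "finite X"
    using fin by (simp add: X_def RCOSETS_def)
  then have "card (X - M) = card X - card M"
    by (intro card_Diff_subset) (auto simp: M_def)
  ultimately have "p dvd card (X - M)"
    by (simp add: dvd_diff_nat)
  moreover have HX: "H \<in> X - M"
  proof -
    have "H #> h = H" if "h \<in> H" for h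
      using that H(1) HG by (simp add: coset_join2 subset_iff)
    then show ?thesis
      using subgroup.subgroup_in_rcosets[OF H(1) is_group] by (simp add: X_def M_def)
  qed
  ultimately have "card (X - M) \<noteq> 1" "X - M \<noteq> {}"
    using p by auto
  then obtain C where C: "C \<in> X - M" "C \<noteq> H"
    using HX by (metis is_singletonI' is_singleton_altdef)
  then obtain a where a: "a \<in> carrier G" "C = H #> a"
    by (auto simp: X_def RCOSETS_def)
  have "a \<notin> H"
    using a C H(1) by (metis coset_join2)
  moreover have "a \<otimes> h \<otimes> inv a \<in> H" if "h \<in> H" for h
    using C a that HG rcoset_fixed_iff[OF H(1) a(1), of h] by (auto simp: M_def)
  ultimately show ?thesis
    using that a(1) by blast
qed

text \<open>Induction on \<open>card P - card H\<close>: a proper \<open>H\<close> is normal in its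
  normalizer \<open>N\<close> within \<open>P\<close>, and \<open>N\<close> is strictly larger by
  \<open>normalizer_grows\<close>.\<close>

lemma (in group) subnormal_in_p_subgroup:
  assumes p: "prime p" and P: "subgroup P G" "card P = p ^ k"
    and H: "subgroup H G" "H \<subseteq> P"
  shows "subnormal G H P"
  using H
proof (induction "card P - card H" arbitrary: H rule: less_induct)
  case less
  have finP: "finite P"
    using P(2) p by (metis card.infinite power_not_zero not_prime_0)
  have PG: "P \<subseteq> carrier G"
    using P(1) subgroup.subset by blast
  interpret P: group "G\<lparr>carrier := P\<rparr>"
    using subgroup_imp_group[OF P(1)] .
  show ?case
  proof (cases "H = P")
    case True
    then show ?thesis
      using P(1) by (simp add: subnormal.refl)
  next
    case False
    define N where "N = {a \<in> P. \<forall>h\<in>H. a \<otimes> h \<otimes> inv a \<in> H}"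
    have HP: "subgroup H (G\<lparr>carrier := P\<rparr>)"
      using less.prems P(1) by (simp add: subgroup_incl)
    obtain a where a: "a \<in> P" "a \<notin> H" "\<And>h. h \<in> H \<Longrightarrow> a \<otimes> h \<otimes> inv a \<in> H"
      using P.normalizer_grows[OF _ p HP, of k] finP False P by (auto simp: order_def)
    have HN: "H \<subseteq> N"
    proof
      fix g assume g: "g \<in> H"
      then have "\<forall>h\<in>H. g \<otimes> h \<otimes> inv g \<in> H"
        by (simp add: less.prems(1) subgroup.m_closed subgroup.m_inv_closed)
      then show "g \<in> N"
        using g less.prems(2) by (auto simp: N_def)
    qed
    have "subgroup N G"
    proof (rule subgroupI)
      show "N \<subseteq> carrier G" "N \<noteq> {}"
        using PG a by (auto simp: N_def)
      show "g \<otimes> h \<in> N" if g: "g \<in> N" and h: "h \<in> N" for g h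
      proof -
        have carr: "g \<in> carrier G" "h \<in> carrier G" "g \<in> P" "h \<in> P"
          using g h PG by (auto simp: N_def)
        have "(g \<otimes> h) \<otimes> b \<otimes> inv (g \<otimes> h) \<in> H" if b: "b \<in> H" for b
        proof -
          have "b \<in> carrier G"
            using b less.prems PG by blast
          then have "(g \<otimes> h) \<otimes> b \<otimes> inv (g \<otimes> h) = g \<otimes> (h \<otimes> b \<otimes> inv h) \<otimes> inv g"
            using carr by (simp add: inv_mult_group m_assoc)
          then show ?thesis
            using g h b by (simp add: N_def)
        qed
        moreover have "g \<otimes> h \<in> P"
          using carr P(1) subgroup.m_closed by fast
        ultimately show ?thesis
          by (simp add: N_def)
      qed
      show "inv g \<in> N" if g: "g \<in> N" for g
      proof -
        have carr: "g \<in> carrier G" "g \<in> P"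
          using g PG by (auto simp: N_def)
        \<comment> \<open>The definition of \<open>N\<close> asks for an inclusion only. Conjugation
          is injective and \<open>H\<close> is finite, so it maps \<open>H\<close> onto
          \<open>H\<close>, and the inverse normalizes \<open>H\<close> too.\<close>
        define c where "c b = g \<otimes> b \<otimes> inv g" for b
        have HG: "H \<subseteq> carrier G"
          using less.prems PG by blast
        have "c ` H \<subseteq> H"
          using g by (auto simp: N_def c_def)
        moreover have "inj_on c H"
          using carr HG by (intro inj_onI) (simp add: c_def subset_iff)
        moreover have "finite H"
          using finP less.prems finite_subset by blast
        ultimately have "c ` H = H"
          by (simp add: endo_inj_surj)
        have "inv g \<otimes> b \<otimes> inv (inv g) \<in> H" if b: "b \<in> H" for b
        proof -
          obtain b' where b': "b' \<in> H" "b = c b'"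
            using \<open>c ` H = H\<close> b by blast
          then have "b' \<in> carrier G"
            using HG by blast
          then have "inv g \<otimes> b \<otimes> inv (inv g) = b'"
            using carr b'(2) by (simp add: c_def m_assoc) (simp add: m_assoc[symmetric])
          then show ?thesis
            using b' by simp
        qed
        moreover have "inv g \<in> P"
          using carr P(1) subgroup.m_inv_closed by fast
        ultimately show ?thesis
          by (simp add: N_def)
      qed
    qed
    moreover have "N \<subseteq> P"
      by (auto simp: N_def)
    moreover have "card P - card N < card P - card H"
    proof -
      have "H \<subset> N"
        using HN a by (auto simp: N_def)
      then have "card H < card N"
        using \<open>N \<subseteq> P\<close> finP finite_subset psubset_card_mono by metis
      moreover have "card N \<le> card P"
        using \<open>N \<subseteq> P\<close> finP card_mono by blast
      ultimately show ?thesis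
        by simp
    qed
    ultimately have "subnormal G N P"
      using less.hyps by blast
    moreover have "H \<lhd> G\<lparr>carrier := N\<rparr>"
      using normal_in_subgroup_iff[OF \<open>subgroup N G\<close>] less.prems(1) HN by (auto simp: N_def)
    ultimately show ?thesis
      by (rule subnormal.step)
  qed
qed

section \<open>Sylow overgroups, p-cores and subnormality\<close>

text \<open>The p-group condition is put on single elements, so it makes sense for the union
  defining the p-core before that union is known to be a subgroup; \<open>card_p_torsion\<close>
  converts it to an order.\<close>

definition p_torsion :: "('a, 'b) monoid_scheme \<Rightarrow> nat \<Rightarrow> 'a set \<Rightarrow> bool" where
  "p_torsion G p Q \<longleftrightarrow> (\<forall>q\<in>Q. \<exists>e. q [^]\<^bsub>G\<^esub> (p ^ e) = \<one>\<^bsub>G\<^esub>)"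

text \<open>By Cauchy's theorem, every prime dividing the order of \<open>Q\<close> is the order of
  an element, hence divides a power of \<open>p\<close>.\<close>

lemma (in group) card_p_torsion:
  assumes fin: "finite (carrier G)" and p: "prime p"
    and Q: "subgroup Q G" "p_torsion G p Q"
  shows "\<exists>k. card Q = p ^ k"
proof -
  have QG: "Q \<subseteq> carrier G"
    using Q(1) subgroup.subset by blast
  have finQ: "finite Q"
    using fin QG finite_subset by blast
  have "card Q \<noteq> 0"
    using finQ subgroup.one_closed[OF Q(1)] by auto
  interpret Q: group "G\<lparr>carrier := Q\<rparr>"
    using subgroup_imp_group[OF Q(1)] .
  have only_p: "q = p" if q: "prime q" "q dvd card Q" for q
  proof -
    \<comment> \<open>Sylow's theorem with exponent 1 gives a subgroup of order \<open>q\<close>;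
      any nontrivial element of it has order \<open>q\<close>.\<close>
    obtain c where "card Q = q ^ 1 * c"
      using q(2) by auto
    then obtain H where H: "subgroup H (G\<lparr>carrier := Q\<rparr>)" "card H = q"
      using sylow_thm[OF q(1) Q.is_group, of 1 c] finQ by (auto simp: order_def)
    have "\<exists>h\<in>H. h \<noteq> \<one>"
    proof (rule ccontr)
      assume "\<not> ?thesis"
      then have "H \<subseteq> {\<one>}"
        by blast
      then have "card H \<le> 1"
        using card_mono[of "{\<one>}" H] by simp
      then show False
        using H(2) prime_gt_1_nat[OF q(1)] by simp
    qed
    then obtain h where h: "h \<in> H" "h \<noteq> \<one>"
      by blast
    have HG: "subgroup H G"
      using incl_subgroup[OF Q(1) H(1)] .
    then interpret H: group "G\<lparr>carrier := H\<rparr>"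
      by (rule subgroup_imp_group)
    have hG: "h \<in> carrier G" "h \<in> Q"
      using h HG H(1) subgroup.subset by fastforce+
    have "h [^]\<^bsub>G\<lparr>carrier := H\<rparr>\<^esub> order (G\<lparr>carrier := H\<rparr>) = \<one>"
      using H.pow_order_eq_1[of h] h by simp
    then have "h [^] q = \<one>"
      using H(2) nat_pow_consistent[of h q H] by (simp add: order_def)
    then have "ord h dvd q"
      using pow_eq_id hG by blast
    moreover have "ord h \<noteq> 1"
      using ord_eq_1 hG h by blast
    ultimately have "ord h = q"
      using q(1) prime_nat_iff by blast
    moreover obtain e where "h [^] (p ^ e) = \<one>"
      using Q(2) hG by (auto simp: p_torsion_def)
    ultimately have "q dvd p ^ e"
      using pow_eq_id hG by blast
    then show ?thesis
      using p q(1) prime_dvd_power primes_dvd_imp_eq by blast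
  qed
  obtain c where c: "card Q = p ^ multiplicity p (card Q) * c" "\<not> p dvd c"
    using multiplicity_decompose'[of "card Q" p] \<open>card Q \<noteq> 0\<close> p prime_gt_1_nat
    by (metis not_prime_unit)
  have "c = 1"
  proof (rule ccontr)
    assume "c \<noteq> 1"
    then obtain q where "prime q" "q dvd c"
      using prime_factor_nat by blast
    then show False
      using only_p c by (metis dvd_mult)
  qed
  then show ?thesis
    using c(1) by auto
qed

section \<open>Conjugate subgroups and Sylow overgroups\<close>

lemma (in group) conj_image_subgroup:
  assumes K: "subgroup K G" and a: "a \<in> carrier G"
  shows "subgroup ((\<lambda>k. a \<otimes> k \<otimes> inv a) ` K) G"
proof -
  have KG: "K \<subseteq> carrier G"
    using K subgroup.subset by blast
  have mult: "(a \<otimes> k \<otimes> inv a) \<otimes> (a \<otimes> l \<otimes> inv a) = a \<otimes> (k \<otimes> l) \<otimes> inv a"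
    if "k \<in> carrier G" "l \<in> carrier G" for k l
  proof -
    have "(a \<otimes> k \<otimes> inv a) \<otimes> (a \<otimes> l \<otimes> inv a) = a \<otimes> k \<otimes> (inv a \<otimes> a) \<otimes> l \<otimes> inv a"
      using a that by (simp only: m_assoc m_closed inv_closed)
    then show ?thesis
      using a that by (simp add: m_assoc)
  qed
  show ?thesis
  proof (rule subgroupI)
    show "(\<lambda>k. a \<otimes> k \<otimes> inv a) ` K \<subseteq> carrier G"
      using KG a by auto
    show "(\<lambda>k. a \<otimes> k \<otimes> inv a) ` K \<noteq> {}"
      using subgroup.one_closed[OF K] by blast
    show "inv g \<in> (\<lambda>k. a \<otimes> k \<otimes> inv a) ` K" if g: "g \<in> (\<lambda>k. a \<otimes> k \<otimes> inv a) ` K" for g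
    proof -
      obtain k where k: "k \<in> K" "g = a \<otimes> k \<otimes> inv a"
        using g by blast
      then have "inv g = a \<otimes> inv k \<otimes> inv a"
        using a KG by (simp add: subset_iff inv_mult_group m_assoc)
      then show ?thesis
        using k K subgroup.m_inv_closed by fast
    qed
    show "g \<otimes> h \<in> (\<lambda>k. a \<otimes> k \<otimes> inv a) ` K"
      if g: "g \<in> (\<lambda>k. a \<otimes> k \<otimes> inv a) ` K" and h: "h \<in> (\<lambda>k. a \<otimes> k \<otimes> inv a) ` K" for g h
    proof -
      obtain k l where "k \<in> K" "g = a \<otimes> k \<otimes> inv a" "l \<in> K" "h = a \<otimes> l \<otimes> inv a"
        using g h by blast
      then show ?thesis
        using mult KG K subgroup.m_closed[OF K, of k l] by (auto simp: subset_iff)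
    qed
  qed
qed

lemma (in group) conj_nat_pow:
  assumes "a \<in> carrier G" "q \<in> carrier G"
  shows "(a \<otimes> q \<otimes> inv a) [^] (n::nat) = a \<otimes> q [^] n \<otimes> inv a"
proof (induction n)
  case 0
  then show ?case
    using assms by simp
next
  case (Suc n)
  have "(a \<otimes> q \<otimes> inv a) [^] Suc n = a \<otimes> q [^] n \<otimes> (inv a \<otimes> a) \<otimes> q \<otimes> inv a"
    using assms Suc by (simp only: nat_pow_Suc m_assoc m_closed inv_closed nat_pow_closed)
  then show ?case
    using assms by (simp add: m_assoc)
qed

lemma (in group) conj_mem_iff:
  assumes "subgroup K G" "a \<in> carrier G" "g \<in> carrier G"
  shows "g \<in> (\<lambda>k. a \<otimes> k \<otimes> inv a) ` K \<longleftrightarrow> inv a \<otimes> g \<otimes> a \<in> K"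
proof
  assume "inv a \<otimes> g \<otimes> a \<in> K"
  moreover have "g = a \<otimes> (inv a \<otimes> g \<otimes> a) \<otimes> inv a"
    using assms by (simp add: m_assoc) (simp add: m_assoc[symmetric])
  ultimately show "g \<in> (\<lambda>k. a \<otimes> k \<otimes> inv a) ` K"
    by blast
next
  assume "g \<in> (\<lambda>k. a \<otimes> k \<otimes> inv a) ` K"
  then obtain k where k: "k \<in> K" "g = a \<otimes> k \<otimes> inv a"
    by blast
  moreover have "k \<in> carrier G"
    using k assms subgroup.mem_carrier by fast
  ultimately have "inv a \<otimes> g \<otimes> a = k"
    using assms by (simp add: m_assoc) (simp add: m_assoc[symmetric])
  then show "inv a \<otimes> g \<otimes> a \<in> K"
    using k by simp
qed

text \<open>\<open>H\<close> acts on the cosets of a Sylow subgroup \<open>K\<close>. Their number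
  is prime to \<open>p\<close>, so some coset \<open>K #> b\<close> is fixed, and \<open>H\<close>
  lies in the conjugate of \<open>K\<close> by \<open>inv b\<close>.\<close>

lemma (in group) sylow_containing:
  assumes fin: "finite (carrier G)" and p: "prime p"
    and order: "order G = p ^ a * c" "\<not> p dvd c"
    and H: "subgroup H G" "card H = p ^ k"
  obtains P where "subgroup P G" "card P = p ^ a" "H \<subseteq> P"
proof -
  obtain K where K: "subgroup K G" "card K = p ^ a"
    using sylow_thm[OF p is_group order(1) fin] by blast
  have "card (rcosets K) = c"
    using lagrange[OF K(1)] order p K(2) by (simp add: mult.commute)
  then have "\<not> p dvd card (rcosets K)"
    using order by simp
  then have "{C \<in> rcosets K. \<exists>h\<in>H. C #> h \<noteq> C} \<noteq> rcosets K"
    using prime_dvd_card_moved_cosets[OF fin p H K(1)] by metis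
  then obtain C where C: "C \<in> rcosets K" "\<And>h. h \<in> H \<Longrightarrow> C #> h = C"
    by blast
  then obtain b where b: "b \<in> carrier G" "C = K #> b"
    by (auto simp: RCOSETS_def)
  define P where "P = (\<lambda>k. inv b \<otimes> k \<otimes> inv (inv b)) ` K"
  have KG: "K \<subseteq> carrier G"
    using K subgroup.subset by blast
  show ?thesis
  proof
    show "subgroup P G"
      unfolding P_def by (rule conj_image_subgroup) (use K b in \<open>auto\<close>)
    have "inj_on (\<lambda>k. inv b \<otimes> k \<otimes> inv (inv b)) K"
      using b KG by (intro inj_onI) (simp add: subset_iff)
    then show "card P = p ^ a"
      unfolding P_def using K by (simp add: card_image)
    show "H \<subseteq> P"
    proof
      fix h assume h: "h \<in> H"
      then have hG: "h \<in> carrier G"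
        using H subgroup.mem_carrier by fast
      then have "b \<otimes> h \<otimes> inv b \<in> K"
        using rcoset_fixed_iff[OF K(1) b(1), of h] C(2)[OF h] b(2) by simp
      then show "h \<in> P"
        unfolding P_def using conj_mem_iff[OF K(1), of "inv b" h] b(1) hG by simp
    qed
  qed
qed

text \<open>Modulo \<open>R\<close> the product \<open>q \<otimes> r\<close> equals
  \<open>q\<close>, so raising it to a suitable power of \<open>p\<close> lands in \<open>R\<close>,
  and a further such power gives the identity.\<close>

lemma (in group) p_torsion_mult:
  assumes Q: "subgroup Q G" "p_torsion G p Q" and R: "subgroup R G" "p_torsion G p R"
    and norm: "\<And>a h. a \<in> Q \<Longrightarrow> h \<in> R \<Longrightarrow> a \<otimes> h \<otimes> inv a \<in> R"
    and q: "q \<in> Q" and r: "r \<in> R"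
  shows "\<exists>e. (q \<otimes> r) [^] (p ^ e) = \<one>"
proof -
  have qG: "q \<in> carrier G" and RG: "\<And>r. r \<in> R \<Longrightarrow> r \<in> carrier G"
    using q Q R subgroup.mem_carrier by fast+
  have pow: "\<exists>s\<in>R. (q \<otimes> r) [^] n = q [^] n \<otimes> s" for n :: nat
  proof (induction n)
    case 0
    then show ?case
      using subgroup.one_closed[OF R(1)] by (intro bexI[of _ \<one>]) auto
  next
    case (Suc n)
    then obtain s where s: "s \<in> R" "(q \<otimes> r) [^] n = q [^] n \<otimes> s"
      by blast
    \<comment> \<open>Moving \<open>s\<close> to the right past \<open>q\<close> replaces it by its
      conjugate under \<open>inv q\<close>, which stays in \<open>R\<close>.\<close>
    have "inv q \<otimes> s \<otimes> inv (inv q) \<in> R"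
      using norm s q subgroup.m_inv_closed[OF Q(1)] by blast
    then have "inv q \<otimes> s \<otimes> q \<otimes> r \<in> R"
      using r qG subgroup.m_closed[OF R(1)] by simp
    moreover have "q [^] Suc n \<otimes> (inv q \<otimes> s \<otimes> q \<otimes> r) = q [^] n \<otimes> (q \<otimes> inv q) \<otimes> s \<otimes> q \<otimes> r"
      using qG RG r s by (simp only: nat_pow_Suc m_assoc m_closed inv_closed nat_pow_closed)
    ultimately show ?case
      using s qG RG r by (intro bexI[of _ "inv q \<otimes> s \<otimes> q \<otimes> r"]) (auto simp: m_assoc)
  qed
  obtain e where e: "q [^] (p ^ e) = \<one>"
    using Q q by (auto simp: p_torsion_def)
  obtain s where s: "s \<in> R" "(q \<otimes> r) [^] (p ^ e) = s"
    using pow[of "p ^ e"] e RG by auto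
  then obtain f where "s [^] (p ^ f) = \<one>"
    using R by (auto simp: p_torsion_def)
  then have "(q \<otimes> r) [^] (p ^ (e + f)) = \<one>"
    using s qG RG r by (metis m_closed nat_pow_pow power_add)
  then show ?thesis
    by blast
qed

text \<open>The largest normal p-subgroup, usually written \<open>O_p(G)\<close>.\<close>

definition p_core :: "('a, 'b) monoid_scheme \<Rightarrow> nat \<Rightarrow> 'a set" where
  "p_core G p = \<Union> {Q. Q \<lhd> G \<and> p_torsion G p Q}"

lemma set_multI: "h \<in> H \<Longrightarrow> k \<in> K \<Longrightarrow> h \<otimes>\<^bsub>G\<^esub> k \<in> H <#>\<^bsub>G\<^esub> K"
  unfolding set_mult_def by blast

lemma (in group) set_mult_subgroup:
  assumes H: "subgroup H G" and K: "subgroup K G"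
    and comm: "\<And>h k. h \<in> H \<Longrightarrow> k \<in> K \<Longrightarrow> k \<otimes> h \<in> H <#> K"
  shows "subgroup (H <#> K) G"
proof (rule subgroupI)
  have HG: "\<And>h. h \<in> H \<Longrightarrow> h \<in> carrier G" and KG: "\<And>k. k \<in> K \<Longrightarrow> k \<in> carrier G"
    using H K subgroup.mem_carrier by fast+
  show "H <#> K \<subseteq> carrier G"
    using HG KG by (auto simp: set_mult_def)
  show "H <#> K \<noteq> {}"
    using subgroup.one_closed[OF H] subgroup.one_closed[OF K] by (auto simp: set_mult_def)
  show "inv a \<in> H <#> K" if a: "a \<in> H <#> K" for a
  proof -
    obtain h k where "h \<in> H" "k \<in> K" "a = h \<otimes> k"
      using a by (auto simp: set_mult_def)
    then show ?thesis
      using comm[of "inv h" "inv k"] H K HG KG by (simp add: inv_mult_group subgroup.m_inv_closed)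
  qed
  show "a \<otimes> b \<in> H <#> K" if a: "a \<in> H <#> K" and b: "b \<in> H <#> K" for a b
  proof -
    obtain h k h' k' where hk: "h \<in> H" "k \<in> K" "a = h \<otimes> k" "h' \<in> H" "k' \<in> K" "b = h' \<otimes> k'"
      using a b by (auto simp: set_mult_def)
    obtain h'' k'' where hk2: "h'' \<in> H" "k'' \<in> K" "k \<otimes> h' = h'' \<otimes> k''"
      using comm[OF hk(4,2)] by (auto simp: set_mult_def)
    have "a \<otimes> b = h \<otimes> (k \<otimes> h') \<otimes> k'"
      using hk HG KG by (simp add: m_assoc)
    also have "\<dots> = (h \<otimes> h'') \<otimes> (k'' \<otimes> k')"
      using hk hk2 HG KG by (simp add: m_assoc)
    finally show ?thesis
      using hk hk2 H K by (simp add: set_multI subgroup.m_closed)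
  qed
qed

lemma (in group) normal_mult_p_torsion:
  assumes Q: "Q \<lhd> G" "p_torsion G p Q" and R: "R \<lhd> G" "p_torsion G p R"
  shows "Q <#> R \<lhd> G" "p_torsion G p (Q <#> R)"
proof -
  have sub: "subgroup Q G" "subgroup R G"
    using Q R normal_imp_subgroup by blast+
  have QG: "Q \<subseteq> carrier G" and RG: "R \<subseteq> carrier G"
    using sub subgroup.subset by blast+
  have "subgroup (Q <#> R) G"
  proof (rule set_mult_subgroup[OF sub])
    fix q r assume qr: "q \<in> Q" "r \<in> R"
    then have "r \<otimes> q \<otimes> inv r \<in> Q" "r \<otimes> q = (r \<otimes> q \<otimes> inv r) \<otimes> r"
      using normal.inv_op_closed2[OF Q(1)] QG RG by (auto simp: m_assoc subset_iff)
    then show "r \<otimes> q \<in> Q <#> R"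
      using qr set_multI by metis
  qed
  moreover have "a \<otimes> h \<otimes> inv a \<in> Q <#> R" if a: "a \<in> carrier G" and h: "h \<in> Q <#> R" for a h
  proof -
    obtain q r where qr: "q \<in> Q" "r \<in> R" "h = q \<otimes> r"
      using h by (auto simp: set_mult_def)
    have G: "q \<in> carrier G" "r \<in> carrier G"
      using qr QG RG by blast+
    have "(a \<otimes> q \<otimes> inv a) \<otimes> (a \<otimes> r \<otimes> inv a) = a \<otimes> q \<otimes> (inv a \<otimes> a) \<otimes> r \<otimes> inv a"
      using a G by (simp only: m_assoc m_closed inv_closed)
    then have "(a \<otimes> q \<otimes> inv a) \<otimes> (a \<otimes> r \<otimes> inv a) = a \<otimes> h \<otimes> inv a"
      using a G qr(3) by (simp add: m_assoc)
    moreover have "a \<otimes> q \<otimes> inv a \<in> Q" "a \<otimes> r \<otimes> inv a \<in> R"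
      using qr a normal.inv_op_closed2[OF Q(1)] normal.inv_op_closed2[OF R(1)] by blast+
    ultimately show ?thesis
      using set_multI[of "a \<otimes> q \<otimes> inv a" Q "a \<otimes> r \<otimes> inv a" R G] by simp
  qed
  ultimately show "Q <#> R \<lhd> G"
    by (simp add: normal_inv_iff)
  have "a \<otimes> h \<otimes> inv a \<in> R" if "a \<in> Q" "h \<in> R" for a h
    using that QG normal.inv_op_closed2[OF R(1), of a h] by blast
  then show "p_torsion G p (Q <#> R)"
    using p_torsion_mult[OF sub(1) Q(2) sub(2) R(2)] by (auto simp: p_torsion_def set_mult_def)
qed

text \<open>Two elements of the union may come from different normal p-subgroups; the product of
  these subgroups is again a normal p-subgroup and contains the product of the elements.\<close>

lemma (in group) p_core_subgroup: "subgroup (p_core G p) G"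
proof (rule subgroupI)
  show "p_core G p \<subseteq> carrier G"
    using subgroup.subset normal_imp_subgroup by (fastforce simp: p_core_def)
  have "p_torsion G p {\<one>}"
    by (simp add: p_torsion_def)
  then show "p_core G p \<noteq> {}"
    using one_is_normal by (auto simp: p_core_def)
  show "inv a \<in> p_core G p" if "a \<in> p_core G p" for a
    using that normal_imp_subgroup subgroup.m_inv_closed by (fastforce simp: p_core_def)
  show "a \<otimes> b \<in> p_core G p" if a: "a \<in> p_core G p" and b: "b \<in> p_core G p" for a b
  proof -
    obtain Q R where "Q \<lhd> G" "p_torsion G p Q" "a \<in> Q" "R \<lhd> G" "p_torsion G p R" "b \<in> R"
      using a b by (auto simp: p_core_def)
    then show ?thesis
      using normal_mult_p_torsion[of Q p R] set_multI[of a Q b R G] unfolding p_core_def by blast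
  qed
qed

lemma p_torsion_p_core: "p_torsion G p (p_core G p)"
  by (auto simp: p_torsion_def p_core_def)

lemma p_torsion_restrict [simp]: "p_torsion (G\<lparr>carrier := H\<rparr>) p Q \<longleftrightarrow> p_torsion G p Q"
  by (simp add: p_torsion_def nat_pow_def)

text \<open>The p-core is characteristic: conjugation by an element of \<open>L\<close> maps
  \<open>H\<close> to itself and so permutes the normal p-subgroups of \<open>H\<close>.\<close>

lemma (in group) p_core_normal_of_normal:
  assumes L: "subgroup L G" and H: "H \<lhd> G\<lparr>carrier := L\<rparr>"
  shows "p_core (G\<lparr>carrier := H\<rparr>) p \<lhd> G\<lparr>carrier := L\<rparr>"
proof -
  have HG: "subgroup H G" "H \<subseteq> L" "\<And>a h. a \<in> L \<Longrightarrow> h \<in> H \<Longrightarrow> a \<otimes> h \<otimes> inv a \<in> H"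
    using H normal_in_subgroup_iff[OF L] by auto
  interpret H: group "G\<lparr>carrier := H\<rparr>"
    using subgroup_imp_group[OF HG(1)] .
  have sub: "subgroup (p_core (G\<lparr>carrier := H\<rparr>) p) (G\<lparr>carrier := H\<rparr>)"
    by (rule H.p_core_subgroup)
  have LG: "\<And>a. a \<in> L \<Longrightarrow> a \<in> carrier G"
    using L subgroup.mem_carrier by fast
  have "a \<otimes> q \<otimes> inv a \<in> p_core (G\<lparr>carrier := H\<rparr>) p"
    if a: "a \<in> L" and q: "q \<in> p_core (G\<lparr>carrier := H\<rparr>) p" for a q
  proof -
    obtain Q where Q: "Q \<lhd> G\<lparr>carrier := H\<rparr>" "p_torsion G p Q" "q \<in> Q"
      using q by (auto simp: p_core_def)
    have QG: "subgroup Q G" "Q \<subseteq> H" "\<And>a h. a \<in> H \<Longrightarrow> h \<in> Q \<Longrightarrow> a \<otimes> h \<otimes> inv a \<in> Q"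
      using Q(1) normal_in_subgroup_iff[OF HG(1)] by auto
    define R where "R = (\<lambda>q. a \<otimes> q \<otimes> inv a) ` Q"
    have "subgroup R G"
      unfolding R_def by (rule conj_image_subgroup) (use QG(1) a LG in \<open>auto\<close>)
    moreover have "R \<subseteq> H"
      using HG a QG(2) by (auto simp: R_def)
    moreover have "h \<otimes> r \<otimes> inv h \<in> R" if h: "h \<in> H" and r: "r \<in> R" for h r
    proof -
      obtain s where s: "s \<in> Q" "r = a \<otimes> s \<otimes> inv a"
        using r by (auto simp: R_def)
      have carr: "a \<in> carrier G" "h \<in> carrier G" "s \<in> carrier G"
        using a h s LG HG QG by blast+
      \<comment> \<open>Conjugating \<open>R\<close> by \<open>h\<close> amounts to conjugating
        \<open>Q\<close> by \<open>b\<close>, which lies in \<open>H\<close> because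
        \<open>H\<close> is normal in \<open>L\<close>.\<close>
      define b where "b = inv a \<otimes> h \<otimes> a"
      have "b \<in> H"
        using HG(3)[of "inv a" h] a h carr L by (simp add: b_def subgroup.m_inv_closed)
      then have "b \<otimes> s \<otimes> inv b \<in> Q"
        using QG s by blast
      moreover have "inv a \<otimes> (h \<otimes> r \<otimes> inv h) \<otimes> a = b \<otimes> s \<otimes> inv b"
        using carr by (simp add: b_def s(2) inv_mult_group m_assoc)
      ultimately show ?thesis
        unfolding R_def using conj_mem_iff[OF QG(1) carr(1), of "h \<otimes> r \<otimes> inv h"] carr s(2) by simp
    qed
    moreover have "p_torsion G p R"
      unfolding p_torsion_def
    proof
      fix r assume "r \<in> R"
      then obtain s where s: "s \<in> Q" "r = a \<otimes> s \<otimes> inv a"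
        by (auto simp: R_def)
      then obtain e where "s [^] (p ^ e) = \<one>"
        using Q(2) by (auto simp: p_torsion_def)
      moreover have "a \<in> carrier G" "s \<in> carrier G"
        using a s LG HG QG by blast+
      ultimately have "r [^] (p ^ e) = \<one>"
        using s(2) by (simp add: conj_nat_pow)
      then show "\<exists>e. r [^] (p ^ e) = \<one>" ..
    qed
    ultimately have "R \<lhd> G\<lparr>carrier := H\<rparr>" "p_torsion (G\<lparr>carrier := H\<rparr>) p R"
      using normal_in_subgroup_iff[OF HG(1)] by auto
    then show ?thesis
      using Q(3) by (auto simp: p_core_def R_def)
  qed
  moreover have "subgroup (p_core (G\<lparr>carrier := H\<rparr>) p) G" "p_core (G\<lparr>carrier := H\<rparr>) p \<subseteq> L"
    using incl_subgroup[OF HG(1) sub] subgroup.subset[OF sub] HG(2) by auto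
  ultimately show ?thesis
    using normal_in_subgroup_iff[OF L] by blast
qed

lemma (in group) subnormal_imp_subgroup:
  "subnormal G H K \<Longrightarrow> subgroup H G \<and> subgroup K G \<and> H \<subseteq> K"
  by (induction rule: subnormal.induct) (use normal_in_subgroup_iff in blast)+

text \<open>Climbing the chain from \<open>H\<close> to \<open>K\<close>, the p-core of each term is
  normal in the next term and is swallowed by the p-core there.\<close>

lemma (in group) subnormal_p_torsion:
  assumes "subnormal G H K" and "p_torsion G p H"
  obtains Q where "Q \<lhd> G\<lparr>carrier := K\<rparr>" "p_torsion G p Q" "H \<subseteq> Q"
proof -
  \<comment> \<open>The induction needs an arbitrary normal p-subgroup \<open>T\<close> of the
    bottom term, since this term changes from step to step.\<close>
  have "\<exists>Q. Q \<lhd> G\<lparr>carrier := K\<rparr> \<and> p_torsion G p Q \<and> T \<subseteq> Q"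
    if "T \<lhd> G\<lparr>carrier := H\<rparr>" "p_torsion G p T" for T
    using assms(1) that
  proof (induction arbitrary: T rule: subnormal.induct)
    case refl
    then show ?case
      by blast
  next
    case (step L K H)
    have "p_core (G\<lparr>carrier := H\<rparr>) p \<lhd> G\<lparr>carrier := L\<rparr>"
      by (rule p_core_normal_of_normal) (use step.hyps subnormal_imp_subgroup in \<open>auto\<close>)
    moreover have "p_torsion G p (p_core (G\<lparr>carrier := H\<rparr>) p)"
      using p_torsion_p_core[of "G\<lparr>carrier := H\<rparr>" p] by simp
    moreover have "T \<subseteq> p_core (G\<lparr>carrier := H\<rparr>) p"
      using step.prems by (auto simp: p_core_def)
    ultimately show ?case
      using step.IH by (meson subset_trans)
  qed
  moreover have "H \<lhd> G\<lparr>carrier := H\<rparr>"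
    using subnormal_imp_subgroup[OF assms(1)] by (simp add: normal_in_subgroup_iff subgroup.m_closed subgroup.m_inv_closed)
  ultimately show ?thesis
    using assms(2) that by blast
qed

section \<open>Operations on subnormal chains\<close>

lemma (in group) subnormal_Int:
  assumes "subnormal G H K" "subgroup M G"
  shows "subnormal G (H \<inter> M) (K \<inter> M)"
  using assms
proof (induction rule: subnormal.induct)
  case (refl K)
  then show ?case
    by (simp add: subgroups_Inter_pair subnormal.refl)
next
  case (step L K H)
  then show ?case
    using subnormal_imp_subgroup by (blast intro: subnormal.step normal_inter)
qed

lemma (in group) subnormal_intermediate:
  assumes "subnormal G H K" "subgroup M G" "H \<subseteq> M" "M \<subseteq> K"
  shows "subnormal G H M"
  using subnormal_Int[OF assms(1,2)] assms(3,4) by (simp add: inf.absorb1 inf.absorb2)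

text \<open>The map is a homomorphism on \<open>M\<close> only, as is the restriction of
  permutations to a set, which respects composition on those preserving the set.\<close>

lemma (in group) subnormal_image:
  assumes G': "group G'" and f: "f \<in> hom (G\<lparr>carrier := M\<rparr>) G'" and M: "subgroup M G"
    and sub: "subnormal G H K" "K \<subseteq> M"
  shows "subnormal G' (f ` H) (f ` K)"
proof -
  interpret G': group G' by (rule G')
  interpret f: group_hom "G\<lparr>carrier := M\<rparr>" G' f
    using f subgroup_imp_group[OF M] G' by (simp add: group_hom_def group_hom_axioms_def)
  have img: "subgroup (f ` L) G'" if "subgroup L G" "L \<subseteq> M" for L
    using that M by (intro f.subgroup_img_is_subgroup) (simp add: subgroup_incl)
  show ?thesis
    using sub
  proof (induction rule: subnormal.induct)
    case (refl K)
    then show ?case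
      using img by (simp add: subnormal.refl)
  next
    case (step L K H)
    have L: "subgroup L G" "L \<subseteq> M"
      using step subnormal_imp_subgroup by blast+
    have H: "subgroup H G" "H \<subseteq> L" "\<And>a h. a \<in> L \<Longrightarrow> h \<in> H \<Longrightarrow> a \<otimes> h \<otimes> inv a \<in> H"
      using step.hyps(2) normal_in_subgroup_iff[OF L(1)] by auto
    have "f a \<otimes>\<^bsub>G'\<^esub> f h \<otimes>\<^bsub>G'\<^esub> inv\<^bsub>G'\<^esub> f a \<in> f ` H" if a: "a \<in> L" and h: "h \<in> H" for a h
    proof -
      have M': "a \<in> M" "h \<in> M" "inv a \<in> M" "a \<otimes> h \<in> M"
        using a h H(2) L(2) M by (auto simp: subgroup.m_inv_closed subgroup.m_closed subset_iff)
      have "f (a \<otimes> h \<otimes> inv a) = f a \<otimes>\<^bsub>G'\<^esub> f h \<otimes>\<^bsub>G'\<^esub> f (inv a)"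
        using M' f.hom_mult[of "a \<otimes> h" "inv a"] f.hom_mult[of a h] by simp
      also have "f (inv a) = inv\<^bsub>G'\<^esub> f a"
        using M' f.hom_inv[of a] M by simp
      finally show ?thesis
        using H(3)[OF a h] by (metis image_eqI)
    qed
    moreover have "subgroup (f ` H) G'" "subgroup (f ` L) G'" "f ` H \<subseteq> f ` L"
      using img L H by auto
    ultimately have "f ` H \<lhd> G'\<lparr>carrier := f ` L\<rparr>"
      by (auto simp: G'.normal_in_subgroup_iff)
    then show ?case
      using step subnormal.step by blast
  qed
qed

lemma (in group) commute_generate:
  assumes c: "c \<in> carrier G" and S: "S \<subseteq> carrier G" and comm: "\<And>s. s \<in> S \<Longrightarrow> s \<otimes> c = c \<otimes> s"
    and g: "g \<in> generate G S"
  shows "g \<otimes> c = c \<otimes> g"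
  using g
proof induction
  case one
  then show ?case
    using c by simp
next
  case (incl h)
  then show ?case
    using comm by simp
next
  case (inv h)
  then have h: "h \<in> carrier G" "h \<otimes> c = c \<otimes> h"
    using S comm by auto
  have "inv h \<otimes> c = inv h \<otimes> (c \<otimes> h) \<otimes> inv h"
    using h(1) c by (simp add: m_assoc)
  also have "\<dots> = c \<otimes> inv h"
    unfolding h(2)[symmetric] using h(1) c by (simp add: m_assoc[symmetric])
  finally show ?case .
next
  case (eng g h)
  then have "g \<in> carrier G" "h \<in> carrier G"
    using S generate_in_carrier by blast+
  then show ?case
    using eng c by (metis m_assoc)
qed

text \<open>Every term of the chain is multiplied by \<open>Z\<close>. As \<open>Z\<close>
  centralizes \<open>K\<close>, conjugation acts on the two factors separately, and each term stays
  normal in the next.\<close>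

lemma (in group) subnormal_mult_commuting:
  assumes sub: "subnormal G H K" and Z: "subgroup Z G"
    and comm: "\<And>a b. a \<in> K \<Longrightarrow> b \<in> Z \<Longrightarrow> a \<otimes> b = b \<otimes> a"
  shows "subnormal G (H <#> Z) (K <#> Z)"
proof -
  have ZG: "\<And>z. z \<in> Z \<Longrightarrow> z \<in> carrier G"
    using Z subgroup.mem_carrier by fast
  have setmult: "subgroup (L <#> Z) G" if L: "subgroup L G" "L \<subseteq> K" for L
  proof (rule set_mult_subgroup[OF L(1) Z])
    fix a b assume ab: "a \<in> L" "b \<in> Z"
    then have "b \<otimes> a = a \<otimes> b"
      using comm[of a b] L(2) by (simp add: subset_iff)
    then show "b \<otimes> a \<in> L <#> Z"
      using ab by (simp add: set_multI)
  qed
  show ?thesis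
    using sub comm setmult
  proof (induction rule: subnormal.induct)
    case (refl K)
    then show ?case
      by (simp add: subnormal.refl)
  next
    case (step L K H)
    have L: "subgroup L G" "L \<subseteq> K"
      using step.hyps subnormal_imp_subgroup by blast+
    have H: "subgroup H G" "H \<subseteq> L" "\<And>a h. a \<in> L \<Longrightarrow> h \<in> H \<Longrightarrow> a \<otimes> h \<otimes> inv a \<in> H"
      using step.hyps(2) normal_in_subgroup_iff[OF L(1)] by auto
    have "a \<otimes> h \<otimes> inv a \<in> H <#> Z" if a: "a \<in> L <#> Z" and h: "h \<in> H <#> Z" for a h
    proof -
      obtain b u c v where eq: "a = b \<otimes> u" "b \<in> L" "u \<in> Z" "h = c \<otimes> v" "c \<in> H" "v \<in> Z"
        using a h unfolding set_mult_def by blast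
      have G: "b \<in> carrier G" "u \<in> carrier G" "c \<in> carrier G" "v \<in> carrier G"
        using eq L H ZG subgroup.mem_carrier by fast+
      have uvu: "u \<otimes> v \<otimes> inv u \<in> Z"
        using eq Z by (simp add: subgroup.m_closed subgroup.m_inv_closed)
      have "inv b \<in> K"
        using subgroup.m_inv_closed[OF L(1) eq(2)] L(2) by blast
      have "a \<otimes> h \<otimes> inv a = b \<otimes> (u \<otimes> c) \<otimes> v \<otimes> inv u \<otimes> inv b"
        using G by (simp add: eq inv_mult_group m_assoc)
      also have "u \<otimes> c = c \<otimes> u"
        using eq H L step.prems(1) by (metis subsetD)
      also have "b \<otimes> (c \<otimes> u) \<otimes> v \<otimes> inv u \<otimes> inv b = b \<otimes> c \<otimes> ((u \<otimes> v \<otimes> inv u) \<otimes> inv b)"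
        using G by (simp add: m_assoc)
      also have "(u \<otimes> v \<otimes> inv u) \<otimes> inv b = inv b \<otimes> (u \<otimes> v \<otimes> inv u)"
        using step.prems(1) uvu \<open>inv b \<in> K\<close> by metis
      also have "b \<otimes> c \<otimes> (inv b \<otimes> (u \<otimes> v \<otimes> inv u)) = (b \<otimes> c \<otimes> inv b) \<otimes> (u \<otimes> v \<otimes> inv u)"
        using G by (simp add: m_assoc)
      finally show ?thesis
        using set_multI[OF H(3)[OF eq(2,5)] uvu, of G] by simp
    qed
    moreover have "subgroup (H <#> Z) G" "subgroup (L <#> Z) G" "H <#> Z \<subseteq> L <#> Z"
      using step.prems(2) L H by (auto simp: set_mult_def)
    ultimately have "H <#> Z \<lhd> G\<lparr>carrier := L <#> Z\<rparr>"
      by (simp add: normal_in_subgroup_iff)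
    then show ?case
      using step subnormal.step by blast
  qed
qed

section \<open>Elements and p-subgroups of the subnormalizer\<close>

lemma (in group) mem_subnormalizerI:
  assumes "g \<in> carrier G" "subnormal G (generate G {x}) (generate G {x, g})"
  shows "g \<in> subnormalizer G x"
  using assms unfolding subnormalizer_def by (simp add: generate.incl)

text \<open>The subgroup generated by \<open>x\<close> is subnormal in the p-group \<open>P\<close>,
  hence in every intermediate subgroup, such as the one generated by \<open>x\<close> and an element
  of \<open>P\<close>.\<close>

lemma (in group) p_subgroup_subset_subnormalizer:
  assumes p: "prime p" and P: "subgroup P G" "card P = p ^ k" and x: "x \<in> P"
  shows "P \<subseteq> subnormalizer G x"
proof
  fix g assume g: "g \<in> P"
  have G: "x \<in> carrier G" "g \<in> carrier G"
    using x g P subgroup.mem_carrier by fast+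
  have sub: "generate G {x} \<subseteq> P" "generate G {x, g} \<subseteq> P" "generate G {x} \<subseteq> generate G {x, g}"
    using x g P(1) by (simp_all add: generate_subgroup_incl mono_generate)
  have "subnormal G (generate G {x}) P"
    by (rule subnormal_in_p_subgroup[OF p P]) (use G sub in \<open>simp_all add: generate_is_subgroup\<close>)
  then have "subnormal G (generate G {x}) (generate G {x, g})"
    by (rule subnormal_intermediate[of _ P]) (use G sub in \<open>simp_all add: generate_is_subgroup\<close>)
  then show "g \<in> subnormalizer G x"
    using G by (simp add: mem_subnormalizerI)
qed

text \<open>Serves to pass from the restriction \<open>y\<close> of a permutation to an invariant
  set to the whole permutation \<open>y \<otimes> z\<close>, when \<open>g\<close> moves only points
  of that set. The chain for \<open>y\<close> is multiplied by the group generated by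
  \<open>z\<close> and extended downwards by \<open>X\<close>.\<close>

lemma (in group) subnormal_commuting_factor:
  assumes y: "y \<in> carrier G" and z: "z \<in> carrier G" and g: "g \<in> carrier G"
    and comm: "y \<otimes> z = z \<otimes> y" "g \<otimes> z = z \<otimes> g"
    and sub: "subnormal G (generate G {y}) (generate G {y, g})"
  shows "subnormal G (generate G {y \<otimes> z}) (generate G {y \<otimes> z, g})"
proof -
  define Y where "Y = generate G {y}"
  define Z where "Z = generate G {z}"
  define K where "K = generate G {y, g}"
  define X where "X = generate G {y \<otimes> z}"
  have subs: "subgroup Y G" "subgroup Z G" "subgroup K G" "subgroup X G"
    using y z g by (simp_all add: Y_def Z_def K_def X_def generate_is_subgroup)
  have Kz: "a \<otimes> z = z \<otimes> a" if "a \<in> K" for a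
    by (rule commute_generate[of z "{y, g}"]) (use that y z g comm in \<open>auto simp: K_def\<close>)
  have KZ: "a \<otimes> b = b \<otimes> a" if a: "a \<in> K" and b: "b \<in> Z" for a b
  proof -
    have "a \<in> carrier G"
      using a subs(3) subgroup.mem_carrier by fast
    then have "b \<otimes> a = a \<otimes> b"
      by (rule commute_generate[of a "{z}"]) (use Kz[OF a] b z in \<open>auto simp: Z_def\<close>)
    then show ?thesis
      by simp
  qed
  have sub1: "subnormal G (Y <#> Z) (K <#> Z)"
    unfolding Y_def K_def by (rule subnormal_mult_commuting) (use sub subs KZ in \<open>auto simp: K_def\<close>)
  have yY: "y \<in> Y" and zZ: "z \<in> Z" and yK: "y \<in> K" and gK: "g \<in> K"
    by (auto simp: Y_def Z_def K_def intro: generate.incl)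
  have YK: "Y \<subseteq> K"
    unfolding Y_def K_def by (rule mono_generate) simp
  have YZ: "subgroup (Y <#> Z) G" "subgroup (K <#> Z) G"
    using subnormal_imp_subgroup[OF sub1] by auto
  have yz: "y \<otimes> z \<in> Y <#> Z"
    using yY zZ by (rule set_multI)
  have comm_yz: "(y \<otimes> z) \<otimes> a = a \<otimes> (y \<otimes> z)" if a: "a \<in> Y <#> Z" for a
  proof -
    obtain b c where bc: "b \<in> Y" "c \<in> Z" "a = b \<otimes> c"
      using a unfolding set_mult_def by blast
    have G: "b \<in> carrier G" "c \<in> carrier G"
      using bc subs subgroup.mem_carrier by fast+
    have "b \<otimes> y = y \<otimes> b"
      by (rule commute_generate[of y "{y}"]) (use bc y in \<open>auto simp: Y_def\<close>)
    moreover have "c \<otimes> z = z \<otimes> c"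
      by (rule commute_generate[of z "{z}"]) (use bc z in \<open>auto simp: Z_def\<close>)
    moreover have "b \<otimes> z = z \<otimes> b" "y \<otimes> c = c \<otimes> y"
      using KZ bc zZ yK YK by auto
    ultimately show ?thesis
      using G y z unfolding bc(3) by (metis m_assoc m_closed)
  qed
  have XYZ: "X \<subseteq> Y <#> Z"
    unfolding X_def using yz YZ(1) by (simp add: generate_subgroup_incl)
  \<comment> \<open>The generator \<open>y \<otimes> z\<close> commutes with all of
    \<open>Y <#> Z\<close>, so \<open>X\<close> is central there.\<close>
  have "X \<lhd> G\<lparr>carrier := Y <#> Z\<rparr>"
    unfolding normal_in_subgroup_iff[OF YZ(1)]
  proof (intro conjI ballI)
    fix a h assume a: "a \<in> Y <#> Z" and h: "h \<in> X"
    have G: "a \<in> carrier G" "h \<in> carrier G"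
      using a h YZ subs subgroup.mem_carrier by fast+
    have "h \<otimes> a = a \<otimes> h"
      by (rule commute_generate[of a "{y \<otimes> z}"]) (use G comm_yz[OF a] h y z in \<open>auto simp: X_def\<close>)
    then have "a \<otimes> h \<otimes> inv a = h \<otimes> a \<otimes> inv a"
      by simp
    also have "\<dots> = h"
      using G by (simp add: m_assoc)
    finally have "a \<otimes> h \<otimes> inv a = h" .
    then show "a \<otimes> h \<otimes> inv a \<in> X"
      using h by simp
  qed (use subs XYZ in auto)
  then have sub2: "subnormal G X (K <#> Z)"
    using subnormal.step[OF sub1] by blast
  \<comment> \<open>The group generated by \<open>y \<otimes> z\<close> and \<open>g\<close> lies
    between \<open>X\<close> and \<open>K <#> Z\<close>, so the chain can be cut down to it.\<close>
  have "{y \<otimes> z, g} \<subseteq> K <#> Z"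
    using set_multI[OF yK zZ, of G] set_multI[OF gK subgroup.one_closed[OF subs(2)], of G] g by simp
  then have "generate G {y \<otimes> z, g} \<subseteq> K <#> Z"
    using YZ(2) generate_subgroup_incl by blast
  moreover have "X \<subseteq> generate G {y \<otimes> z, g}"
    unfolding X_def by (rule mono_generate) simp
  moreover have "subgroup (generate G {y \<otimes> z, g}) G"
    using y z g by (simp add: generate_is_subgroup)
  ultimately show ?thesis
    using subnormal_intermediate[OF sub2] by (simp add: X_def)
qed

section \<open>Symmetric groups and 2-elements\<close>

lemma sym_group_on_carrier [simp]: "p \<in> carrier (sym_group_on A) \<longleftrightarrow> p permutes A"
  and sym_group_on_mult [simp]: "p \<otimes>\<^bsub>sym_group_on A\<^esub> q = p \<circ> q"
  and sym_group_on_one [simp]: "\<one>\<^bsub>sym_group_on A\<^esub> = id"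
  by (simp_all add: sym_group_on_def)

lemma group_sym_group_on: "group (sym_group_on A)"
proof (rule groupI)
  show "\<exists>q\<in>carrier (sym_group_on A). q \<otimes>\<^bsub>sym_group_on A\<^esub> p = \<one>\<^bsub>sym_group_on A\<^esub>"
    if "p \<in> carrier (sym_group_on A)" for p
    using that by (auto intro!: bexI[of _ "Hilbert_Choice.inv p"] simp: permutes_inv permutes_inv_o)
qed (auto simp: permutes_compose permutes_id comp_assoc)

lemma sym_group_on_inv [simp]:
  assumes "p permutes A"
  shows "inv\<^bsub>sym_group_on A\<^esub> p = Hilbert_Choice.inv p"
proof -
  interpret group "sym_group_on A" by (rule group_sym_group_on)
  show ?thesis
    using assms by (intro inv_equality) (simp_all add: permutes_inv permutes_inv_o)
qed

lemma sym_group_on_pow [simp]: "p [^]\<^bsub>sym_group_on A\<^esub> (k::nat) = p ^^ k"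
proof -
  interpret group "sym_group_on A" by (rule group_sym_group_on)
  show ?thesis
    by (induction k) (simp_all add: nat_pow_Suc funpow_Suc_right del: funpow.simps)
qed

lemma finite_sym_group_on: "finite A \<Longrightarrow> finite (carrier (sym_group_on A))"
  by (simp add: sym_group_on_def finite_permutations)

lemma order_sym_group_on: "finite A \<Longrightarrow> order (sym_group_on A) = fact (card A)"
  by (simp add: order_def sym_group_on_def card_permutations)

text \<open>Permutations of \<open>B\<close> are functions fixing everything else, so the symmetric
  group on \<open>B\<close> is literally a restriction of the one on \<open>A\<close>, and generated
  subgroups agree in both.\<close>

lemma sym_group_on_subgroup:
  assumes "B \<subseteq> A"
  shows "subgroup {p. p permutes B} (sym_group_on A)"
    and "sym_group_on B = (sym_group_on A)\<lparr>carrier := {p. p permutes B}\<rparr>"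
proof -
  interpret group "sym_group_on A" by (rule group_sym_group_on)
  have BA: "p permutes A" if "p permutes B" for p
    using that assms permutes_subset by blast
  show "subgroup {p. p permutes B} (sym_group_on A)"
  proof (rule subgroupI)
    show "{p. p permutes B} \<noteq> {}"
      using permutes_id by blast
  qed (auto simp: BA permutes_inv permutes_compose)
  show "sym_group_on B = (sym_group_on A)\<lparr>carrier := {p. p permutes B}\<rparr>"
    by (simp add: sym_group_on_def)
qed

lemma (in group) card_generate_singleton:
  assumes "finite (carrier G)" "prime p" "a \<in> carrier G" "a [^] (p ^ e) = \<one>"
  shows "\<exists>k. card (generate G {a}) = p ^ k"
proof -
  have "ord a dvd p ^ e"
    using assms pow_eq_id by blast
  then show ?thesis
    using assms generate_pow_card[of a] divides_primepow_nat by metis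
qed

lemma (in group) p_torsion_generate_singleton:
  assumes "finite (carrier G)" "prime p" "a \<in> carrier G" "a [^] (p ^ e) = \<one>"
  shows "p_torsion G p (generate G {a})"
proof -
  have sub: "subgroup (generate G {a}) G"
    using assms by (simp add: generate_is_subgroup)
  then interpret H: group "G\<lparr>carrier := generate G {a}\<rparr>"
    by (rule subgroup_imp_group)
  obtain k where "card (generate G {a}) = p ^ k"
    using card_generate_singleton[OF assms] by blast
  then have "h [^] (p ^ k) = \<one>" if "h \<in> generate G {a}" for h
    using H.pow_order_eq_1[of h] that nat_pow_consistent[of h "p ^ k" "generate G {a}"]
    by (simp add: order_def)
  then show ?thesis
    unfolding p_torsion_def by blast
qed

text \<open>The order of \<open>P\<close> is the full 2-part of \<open>(2^b)!\<close>. A point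
  stabilizer has order \<open>2^s\<close> dividing \<open>(2^b - 1)!\<close>, so
  \<open>2^(b+s)\<close> divides \<open>(2^b)!\<close> and hence the order of \<open>P\<close>. The
  orbit, of size \<open>2^a / 2^s\<close>, thus has at least \<open>2^b\<close> points.\<close>

lemma two_subgroup_transitive:
  assumes fin: "finite D" and card: "card D = 2 ^ b"
    and P: "subgroup P (sym_group_on D)" "card P = 2 ^ a"
    and fact: "fact (2 ^ b) = 2 ^ a * k" "odd (k::nat)"
    and c: "c \<in> D" and d: "d \<in> D"
  obtains g where "g \<in> P" "g c = d"
proof -
  interpret S: group "sym_group_on D" by (rule group_sym_group_on)
  interpret P: group "(sym_group_on D)\<lparr>carrier := P\<rparr>"
    using S.subgroup_imp_group[OF P(1)] .
  interpret T: group "sym_group_on (D - {c})" by (rule group_sym_group_on)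
  define stab where "stab = {g \<in> P. g c = c}"
  define orb where "orb = (\<lambda>g. g c) ` P"
  have PD: "\<And>g. g \<in> P \<Longrightarrow> g permutes D"
    using subgroup.mem_carrier[OF P(1)] by simp
  have finP: "finite P"
    using P(2) by (simp add: card_ge_0_finite)
  have "card orb * card stab = card P"
    using P.card_orbit_times_stabilizer[of "\<lambda>g. g" c] finP by (simp add: orb_def stab_def order_def)
  then have orb_stab: "card orb * card stab = 2 ^ a"
    using P(2) by simp
  have stab_permutes: "g permutes D - {c}" if "g \<in> stab" for g
    by (rule permutes_superset[of g D]) (use that PD in \<open>auto simp: stab_def\<close>)
  have "subgroup stab (sym_group_on (D - {c}))"
  proof (rule T.subgroupI)
    show "stab \<subseteq> carrier (sym_group_on (D - {c}))"
      using stab_permutes by auto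
    show "stab \<noteq> {}"
      using subgroup.one_closed[OF P(1)] by (auto simp: stab_def)
    show "inv\<^bsub>sym_group_on (D - {c})\<^esub> g \<in> stab" if g: "g \<in> stab" for g
    proof -
      have "g permutes D - {c}"
        using g by (rule stab_permutes)
      moreover have "Hilbert_Choice.inv g \<in> P"
        using subgroup.m_inv_closed[OF P(1), of g] g PD by (simp add: stab_def)
      moreover have "Hilbert_Choice.inv g c = c"
        using g PD permutes_inverses(2)[of g D c] by (simp add: stab_def)
      ultimately show ?thesis
        by (simp add: stab_def)
    qed
    show "g \<otimes>\<^bsub>sym_group_on (D - {c})\<^esub> h \<in> stab" if "g \<in> stab" "h \<in> stab" for g h
      using that subgroup.m_closed[OF P(1), of g h] by (simp add: stab_def)
  qed
  then have "card stab dvd fact (card (D - {c}))"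
    using T.lagrange[of stab] order_sym_group_on[of "D - {c}"] fin by (metis dvd_triv_right finite_Diff)
  moreover have "fact (card D) = card D * fact (card (D - {c}))"
    using c fin by (metis card_Suc_Diff1 fact_Suc of_nat_id)
  moreover obtain s where s: "card stab = 2 ^ s"
    using orb_stab by (metis divides_primepow_nat dvd_triv_right two_is_prime_nat)
  ultimately have "2 ^ (b + s) dvd 2 ^ a * k"
    using card fact(1) by (metis mult_dvd_mono dvd_refl power_add)
  then have "2 ^ (b + s) dvd (2::nat) ^ a"
    using fact(2) by (simp add: coprime_dvd_mult_left_iff)
  then have "2 ^ (b + s) \<le> card orb * card stab"
    using orb_stab by (simp add: dvd_imp_le)
  then have "card D \<le> card orb"
    using card s by (simp add: power_add)
  moreover have "orb \<subseteq> D"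
    using PD c by (auto simp: orb_def permutes_in_image)
  ultimately have "orb = D"
    using fin by (simp add: card_subset_eq card_mono le_antisym)
  then show ?thesis
    using d that by (auto simp: orb_def)
qed

section \<open>Restriction of permutations to invariant sets\<close>

lemma perm_restrict_permutes:
  assumes "x permutes A" "finite D" "\<And>d. d \<in> D \<Longrightarrow> x d \<in> D"
  shows "perm_restrict x D permutes D"
proof (rule bij_imp_permutes)
  have "inj_on (perm_restrict x D) D"
    using assms(1) permutes_inj by (auto simp: inj_on_def perm_restrict_def inj_def)
  moreover have "perm_restrict x D ` D \<subseteq> D"
    using assms(3) by (auto simp: perm_restrict_def)
  ultimately show "bij_betw (perm_restrict x D) D D"
    using assms(2) by (simp add: bij_betw_def endo_inj_surj)
qed (simp add: perm_restrict_def)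

lemma perm_restrict_funpow:
  assumes "\<And>d. d \<in> D \<Longrightarrow> x d \<in> D"
  shows "perm_restrict x D ^^ k = perm_restrict (x ^^ k) D"
proof (induction k)
  case 0
  then show ?case
    by (simp add: perm_restrict_def fun_eq_iff)
next
  case (Suc k)
  have "(x ^^ k) d \<in> D" if "d \<in> D" for d
    using that assms by (induction k) auto
  with Suc show ?case
    by (auto simp: perm_restrict_def fun_eq_iff)
qed

lemma perm_restrict_split:
  assumes "x permutes A" "D \<subseteq> A" "\<And>d. d \<in> D \<Longrightarrow> x d \<in> D" "\<And>d. d \<in> A - D \<Longrightarrow> x d \<in> A - D"
  shows "perm_restrict x D \<circ> perm_restrict x (A - D) = x"
  using assms by (auto simp: perm_restrict_def fun_eq_iff permutes_def)

lemma permutes_disjoint_commute: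
  assumes "p permutes B" "q permutes C" "B \<inter> C = {}"
  shows "p \<circ> q = q \<circ> p"
proof
  fix a
  show "(p \<circ> q) a = (q \<circ> p) a"
  proof (cases "a \<in> B")
    case True
    then have "a \<notin> C" "p a \<notin> C"
      using assms(3) permutes_in_image[OF assms(1), of a] by auto
    then show ?thesis
      using permutes_not_in[OF assms(2)] by simp
  next
    case False
    then have "q a \<notin> B"
      using assms(3) permutes_in_image[OF assms(2), of a] permutes_not_in[OF assms(2), of a] by auto
    then show ?thesis
      using False permutes_not_in[OF assms(1)] by simp
  qed
qed

text \<open>An injective map of the finite set \<open>D\<close> into itself is onto, so no point
  outside can be sent into \<open>D\<close>.\<close>

lemma finite_invariant_complement:
  assumes "x permutes A" "finite D" "\<And>d. d \<in> D \<Longrightarrow> x d \<in> D" "d \<in> A - D"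
  shows "x d \<in> A - D"
proof -
  have "x ` D = D"
    using assms permutes_inj[OF assms(1)] by (intro endo_inj_surj) (auto simp: inj_on_def inj_def)
  then show ?thesis
    using assms permutes_in_image[OF assms(1)] permutes_inj[OF assms(1)]
    by (metis Diff_iff imageE injD)
qed

text \<open>The 2-power order is stated through a trivial power, which passes directly to
  restrictions of \<open>x\<close>.\<close>

locale two_element =
  fixes A :: "'a set" and x :: "'a \<Rightarrow> 'a"
  assumes finite_A: "finite A" and x_permutes: "x permutes A"
    and two_power: "\<exists>e. x ^^ (2 ^ e) = id"
begin

abbreviation S where "S \<equiv> sym_group_on A"
abbreviation Sub where "Sub \<equiv> subnormalizer S x"

sublocale S: group S
  by (rule group_sym_group_on)

lemma Sub_subgroup: "subgroup Sub S"
  by (rule subnormalizer_is_subgroup) (rule S.is_group)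

lemma Sub_comp: "g \<in> Sub \<Longrightarrow> h \<in> Sub \<Longrightarrow> g \<circ> h \<in> Sub"
  using subgroup.m_closed[OF Sub_subgroup] by simp

lemma Sub_permutes: "g \<in> Sub \<Longrightarrow> g permutes A"
  using subgroup.mem_carrier[OF Sub_subgroup] by simp

lemma Sub_inv: "g \<in> Sub \<Longrightarrow> Hilbert_Choice.inv g \<in> Sub"
  using subgroup.m_inv_closed[OF Sub_subgroup] Sub_permutes by fastforce

text \<open>The restriction \<open>y\<close> of \<open>x\<close> lies in a Sylow 2-subgroup of the
  symmetric group on \<open>D\<close>, which is transitive because \<open>card D\<close> is a power
  of 2. Its elements belong to the subnormalizer of \<open>y\<close>, and also to that of
  \<open>x\<close>, since they commute with the remaining factor \<open>z\<close>.\<close>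

lemma Sub_moves_in_invariant_set:
  assumes D: "D \<subseteq> A" "\<And>d. d \<in> D \<Longrightarrow> x d \<in> D" "card D = 2 ^ b" and c: "c \<in> D" and d: "d \<in> D"
  obtains g where "g \<in> Sub" "g permutes D" "g c = d"
proof -
  have fin: "finite D"
    using D(1) finite_A finite_subset by blast
  interpret SD: group "sym_group_on D" by (rule group_sym_group_on)
  define y where "y = perm_restrict x D"
  define z where "z = perm_restrict x (A - D)"
  have compl: "\<And>d. d \<in> A - D \<Longrightarrow> x d \<in> A - D"
    using finite_invariant_complement[OF x_permutes fin D(2)] by blast
  have y: "y permutes D" and z: "z permutes (A - D)"
    unfolding y_def z_def using perm_restrict_permutes[OF x_permutes] fin D(2) compl finite_A by blast+
  obtain e where "x ^^ (2 ^ e) = id"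
    using two_power by blast
  moreover have "y ^^ (2 ^ e) = perm_restrict (x ^^ (2 ^ e)) D"
    unfolding y_def by (rule perm_restrict_funpow) (rule D(2))
  ultimately have "y ^^ (2 ^ e) = id"
    by (simp add: perm_restrict_def fun_eq_iff)
  then obtain j where j: "card (generate (sym_group_on D) {y}) = 2 ^ j"
    using SD.card_generate_singleton[of 2 y e] y fin by (auto simp: finite_sym_group_on)
  \<comment> \<open>The multiplicity of 2 in the factorial is the exponent of the order of a Sylow
    2-subgroup.\<close>
  obtain k where k: "fact (card D) = 2 ^ multiplicity 2 (fact (card D) :: nat) * k" "odd (k::nat)"
    using multiplicity_decompose'[of "fact (card D) :: nat" 2] by auto
  obtain P where P: "subgroup P (sym_group_on D)" "card P = 2 ^ multiplicity 2 (fact (card D) :: nat)"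
      "generate (sym_group_on D) {y} \<subseteq> P"
    using SD.sylow_containing[OF finite_sym_group_on[OF fin] two_is_prime_nat _ k(2) _ j] k(1) y
    by (auto simp: order_sym_group_on fin SD.generate_is_subgroup)
  obtain g where g: "g \<in> P" "g c = d"
    using two_subgroup_transitive[OF fin D(3) P(1,2) _ k(2) c d] k(1) D(3) by metis
  have gD: "g permutes D"
    using subgroup.mem_carrier[OF P(1) g(1)] by simp
  note SD_eq = sym_group_on_subgroup[OF D(1)]
  have PS: "subgroup P S"
    using P(1) unfolding SD_eq(2) by (rule S.incl_subgroup[OF SD_eq(1)])
  have yP: "y \<in> P"
    using P(3) by (auto intro: generate.incl)
  have yzS: "y \<in> carrier S" "z \<in> carrier S" "g \<in> carrier S"
    using y z gD D(1) by (auto intro: permutes_subset)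
  have "subnormal S (generate S {y}) P"
    by (rule S.subnormal_in_p_subgroup[OF two_is_prime_nat PS P(2)])
      (use yP yzS PS in \<open>simp_all add: S.generate_is_subgroup S.generate_subgroup_incl\<close>)
  then have "subnormal S (generate S {y}) (generate S {y, g})"
    by (rule S.subnormal_intermediate)
      (use yP g yzS PS in \<open>simp_all add: S.generate_is_subgroup S.generate_subgroup_incl S.mono_generate\<close>)
  then have "subnormal S (generate S {y \<otimes>\<^bsub>S\<^esub> z}) (generate S {y \<otimes>\<^bsub>S\<^esub> z, g})"
    using permutes_disjoint_commute[OF y z] permutes_disjoint_commute[OF gD z] yzS
    by (intro S.subnormal_commuting_factor) auto
  moreover have "y \<otimes>\<^bsub>S\<^esub> z = x"
    using perm_restrict_split[OF x_permutes D(1,2) compl] by (simp add: y_def z_def)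
  ultimately have "g \<in> Sub"
    using yzS by (simp add: S.mem_subnormalizerI)
  then show ?thesis
    using that g(2) gD by blast
qed

end

section \<open>Transpositions in the subnormalizer\<close>

text \<open>On a cycle the exponent matters modulo the length, whatever the starting point; cycles
  of equal length can therefore be matched power by power.\<close>

lemma funpow_eq_iff_mod_card_orbit:
  assumes "permutation x"
  shows "(x ^^ i) a = (x ^^ j) a \<longleftrightarrow> i mod card (orbit x a) = j mod card (orbit x a)"
proof -
  define k where "k = funpow_dist1 x a a"
  have self: "a \<in> orbit x a"
    using assms by (rule permutation_self_in_orbit)
  have inj: "inj_on (\<lambda>n. (x ^^ n) a) {0..<k}"
    unfolding k_def using self by (rule inj_on_funpow_dist1)
  have "orbit x a = (\<lambda>n. (x ^^ n) a) ` {0..<k}"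
    unfolding k_def using self by (rule orbit_conv_funpow_dist1)
  then have card: "card (orbit x a) = k"
    using inj by (simp add: card_image)
  have "(x ^^ k) a = a"
    unfolding k_def using self by (rule funpow_dist1_prop)
  then have mod: "(x ^^ i) a = (x ^^ (i mod k)) a" for i
    by (simp add: funpow_mod_eq)
  have "k > 0"
    by (simp add: k_def)
  then have "i mod k = j mod k" if "(x ^^ (i mod k)) a = (x ^^ (j mod k)) a"
    using inj that by (auto simp: inj_on_def)
  then show ?thesis
    unfolding card using mod by metis
qed

text \<open>Sends \<open>x^i a\<close> to \<open>x^i b\<close> and back if the two orbits are disjoint and of equal
  size; only then is it meaningful.\<close>

definition cycle_swap :: "('a \<Rightarrow> 'a) \<Rightarrow> 'a \<Rightarrow> 'a \<Rightarrow> 'a \<Rightarrow> 'a" where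
  "cycle_swap x a b p =
    (if p \<in> orbit x a then (x ^^ funpow_dist x a p) b
     else if p \<in> orbit x b then (x ^^ funpow_dist x b p) a else p)"

context
  fixes x :: "'a \<Rightarrow> 'a" and a b :: 'a
  assumes perm: "permutation x"
    and disj: "orbit x a \<inter> orbit x b = {}"
    and card_eq: "card (orbit x a) = card (orbit x b)"
begin

lemma funpow_mem_orbit: "(x ^^ i) c \<in> orbit x c"
  using perm by (auto simp: orbit_altdef_permutation)

text \<open>The exponent returned by \<open>funpow_dist\<close> can differ from \<open>i\<close>,
  but only by a multiple of the common cycle length.\<close>

lemma cycle_swap_left: "cycle_swap x a b ((x ^^ i) a) = (x ^^ i) b"
proof -
  have "(x ^^ funpow_dist x a ((x ^^ i) a)) a = (x ^^ i) a"
    using funpow_mem_orbit by (rule funpow_dist_prop)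
  then have "(x ^^ funpow_dist x a ((x ^^ i) a)) b = (x ^^ i) b"
    using funpow_eq_iff_mod_card_orbit[OF perm] card_eq by metis
  then show ?thesis
    using funpow_mem_orbit by (simp add: cycle_swap_def)
qed

lemma cycle_swap_right: "cycle_swap x a b ((x ^^ i) b) = (x ^^ i) a"
proof -
  have "(x ^^ funpow_dist x b ((x ^^ i) b)) b = (x ^^ i) b"
    using funpow_mem_orbit by (rule funpow_dist_prop)
  then have "(x ^^ funpow_dist x b ((x ^^ i) b)) a = (x ^^ i) a"
    using funpow_eq_iff_mod_card_orbit[OF perm] card_eq by metis
  moreover have "(x ^^ i) b \<notin> orbit x a"
    using disj funpow_mem_orbit by blast
  ultimately show ?thesis
    using funpow_mem_orbit by (simp add: cycle_swap_def)
qed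

lemma cycle_swap_other: "p \<notin> orbit x a \<Longrightarrow> p \<notin> orbit x b \<Longrightarrow> cycle_swap x a b p = p"
  by (simp add: cycle_swap_def)

lemma cycle_swap_cases:
  obtains i where "p = (x ^^ i) a" | i where "p = (x ^^ i) b" | "p \<notin> orbit x a" "p \<notin> orbit x b"
  using orbit_altdef_permutation[OF perm] by blast

lemma cycle_swap_involution: "cycle_swap x a b (cycle_swap x a b p) = p"
  by (rule cycle_swap_cases[of p]) (simp_all add: cycle_swap_left cycle_swap_right cycle_swap_other)

lemma cycle_swap_commute: "cycle_swap x a b (x p) = x (cycle_swap x a b p)"
proof (rule cycle_swap_cases[of p])
  fix i assume "p = (x ^^ i) a"
  then show ?thesis
    using cycle_swap_left[of "Suc i"] cycle_swap_left[of i] by simp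
next
  fix i assume "p = (x ^^ i) b"
  then show ?thesis
    using cycle_swap_right[of "Suc i"] cycle_swap_right[of i] by simp
next
  assume p: "p \<notin> orbit x a" "p \<notin> orbit x b"
  then have "x p \<notin> orbit x a" "x p \<notin> orbit x b"
    using perm by (metis cyclic_on_orbit' cyclic_on_alldef permutation_orbit_step permutation_self_in_orbit)+
  then show ?thesis
    using p by (simp add: cycle_swap_other)
qed

end

context two_element
begin

lemma permutation_x: "permutation x"
  using x_permutes finite_A permutation_permutes by blast

lemma two_subgroup_subset_Sub:
  assumes "subgroup P S" "p_torsion S 2 P" "x \<in> P"
  shows "P \<subseteq> Sub"
proof -
  obtain k where "card P = 2 ^ k"
    using S.card_p_torsion[OF finite_sym_group_on[OF finite_A] two_is_prime_nat assms(1,2)] by blast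
  then show ?thesis
    by (rule S.p_subgroup_subset_subnormalizer[OF two_is_prime_nat assms(1) _ assms(3)])
qed

lemma p_torsion_generate_x: "p_torsion S 2 (generate S {x})"
proof -
  obtain e where "x ^^ (2 ^ e) = id"
    using two_power by blast
  then show ?thesis
    using S.p_torsion_generate_singleton[of 2 x e] finite_sym_group_on[OF finite_A] x_permutes by simp
qed

text \<open>The transposition lies in the elementary abelian group of all permutations fixing or
  swapping each pair \<open>{p, \<phi> p}\<close>, where \<open>\<phi>\<close> exchanges the two cycles; this
  group is normalized by \<open>x\<close>.\<close>

lemma transpose_equal_cycles_in_Sub:
  assumes ab: "a \<in> A" "b \<in> A" and disj: "orbit x a \<inter> orbit x b = {}"
    and card: "card (orbit x a) = card (orbit x b)"
  shows "transpose a b \<in> Sub"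
proof -
  define \<phi> where "\<phi> = cycle_swap x a b"
  note swap = permutation_x disj card
  have invol: "\<phi> (\<phi> p) = p" for p
    unfolding \<phi>_def by (rule cycle_swap_involution[OF swap])
  have comm_x: "\<phi> (x p) = x (\<phi> p)" for p
    unfolding \<phi>_def by (rule cycle_swap_commute[OF swap])
  have \<phi>a: "\<phi> a = b"
    unfolding \<phi>_def using cycle_swap_left[OF swap, of 0] by simp
  have sub: "orbit x a \<subseteq> A" "orbit x b \<subseteq> A"
    using permutes_orbit_subset[OF x_permutes] ab by auto
  have \<phi>A: "\<phi> permutes A"
    unfolding permutes_def
  proof (intro conjI allI impI)
    show "\<phi> p = p" if "p \<notin> A" for p
      unfolding \<phi>_def using that sub by (intro cycle_swap_other[OF swap]) auto
    show "\<exists>!q. \<phi> q = p" for p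
      using invol by metis
  qed
  define N where "N = {g. g permutes A \<and> (\<forall>p. g p = p \<or> g p = \<phi> p)}"
  define X where "X = generate S {x}"
  have X: "subgroup X S" and X_torsion: "p_torsion S 2 X"
    unfolding X_def using x_permutes p_torsion_generate_x by (simp_all add: S.generate_is_subgroup)
  have XA: "h permutes A" if "h \<in> X" for h
    using subgroup.mem_carrier[OF X that] by simp
  have Xinv: "Hilbert_Choice.inv h \<in> X" if "h \<in> X" for h
    using subgroup.m_inv_closed[OF X that] XA[OF that] by simp
  \<comment> \<open>If \<open>g\<close> moves \<open>p\<close> to \<open>\<phi> p\<close>,
    injectivity leaves only \<open>p\<close> as the image of \<open>\<phi> p\<close>.\<close>
  have square: "g \<circ> g = id" if g: "g \<in> N" for g
  proof
    fix p
    have "g (\<phi> p) = p" if "g p = \<phi> p" "\<phi> p \<noteq> p"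
    proof -
      have "g (\<phi> p) = \<phi> p \<or> g (\<phi> p) = \<phi> (\<phi> p)"
        using g unfolding N_def by blast
      moreover have "g (\<phi> p) \<noteq> g p"
        using g that(2) permutes_inj[of g A] by (auto simp: N_def inj_def)
      ultimately show ?thesis
        using that invol by simp
    qed
    moreover have "g p = p \<or> g p = \<phi> p"
      using g by (simp add: N_def)
    ultimately show "(g \<circ> g) p = id p"
      by (cases "\<phi> p = p") auto
  qed
  have N: "subgroup N S"
  proof (rule S.subgroupI)
    show "N \<subseteq> carrier S"
      by (auto simp: N_def)
    show "N \<noteq> {}"
      using permutes_id[of A] by (auto simp: N_def intro!: exI[of _ id])
    show "inv\<^bsub>S\<^esub> g \<in> N" if g: "g \<in> N" for g
    proof -
      have "inv\<^bsub>S\<^esub> g = g"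
        using g square[OF g] by (intro S.inv_equality) (auto simp: N_def)
      then show ?thesis
        using g by simp
    qed
    show "g \<otimes>\<^bsub>S\<^esub> h \<in> N" if g: "g \<in> N" and h: "h \<in> N" for g h
    proof -
      have "g (h p) = p \<or> g (h p) = \<phi> p" for p
        using g h invol unfolding N_def by (metis (mono_tags, lifting) mem_Collect_eq)
      then show ?thesis
        using g h by (simp add: N_def permutes_compose)
    qed
  qed
  have N_torsion: "p_torsion S 2 N"
    unfolding p_torsion_def
  proof
    fix g assume "g \<in> N"
    then have "g [^]\<^bsub>S\<^esub> ((2::nat) ^ 1) = \<one>\<^bsub>S\<^esub>"
      using square[of g] by (simp add: numeral_2_eq_2)
    then show "\<exists>e. g [^]\<^bsub>S\<^esub> ((2::nat) ^ e) = \<one>\<^bsub>S\<^esub>" ..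
  qed
  have X_comm: "h \<circ> \<phi> = \<phi> \<circ> h" if "h \<in> X" for h
  proof -
    have "h \<otimes>\<^bsub>S\<^esub> \<phi> = \<phi> \<otimes>\<^bsub>S\<^esub> h"
      by (rule S.commute_generate[of _ "{x}"])
        (use \<phi>A x_permutes that comm_x in \<open>auto simp: X_def fun_eq_iff\<close>)
    then show ?thesis
      by simp
  qed
  have norm: "h \<circ> g \<circ> Hilbert_Choice.inv h \<in> N" if h: "h \<in> X" and g: "g \<in> N" for h g
  proof -
    have "(h \<circ> g \<circ> Hilbert_Choice.inv h) p = p \<or> (h \<circ> g \<circ> Hilbert_Choice.inv h) p = \<phi> p" for p
    proof -
      define q where "q = Hilbert_Choice.inv h p"
      have hq: "h q = p"
        unfolding q_def using permutes_inverses(1)[OF XA[OF h]] .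
      have "g q = q \<or> g q = \<phi> q"
        using g by (simp add: N_def)
      then have "h (g q) = h q \<or> h (g q) = h (\<phi> q)"
        by metis
      moreover have "h (\<phi> q) = \<phi> (h q)"
        using X_comm[OF h] by (simp add: fun_eq_iff)
      ultimately show ?thesis
        using hq by (simp add: q_def)
    qed
    then show ?thesis
      using XA[OF h] g by (simp add: N_def permutes_compose permutes_inv)
  qed
  \<comment> \<open>\<open>X\<close> normalizes \<open>N\<close>, so their product is a 2-group; it
    contains both \<open>x\<close> and the transposition.\<close>
  have "subgroup (X <#>\<^bsub>S\<^esub> N) S"
  proof (rule S.set_mult_subgroup[OF X N])
    fix h g assume h: "h \<in> X" and g: "g \<in> N"
    have "h \<circ> (Hilbert_Choice.inv h \<circ> g \<circ> Hilbert_Choice.inv (Hilbert_Choice.inv h)) = g \<circ> h"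
      using permutes_inverses(1)[OF XA[OF h]] permutes_inv_inv[OF XA[OF h]] by (simp add: fun_eq_iff)
    then show "g \<otimes>\<^bsub>S\<^esub> h \<in> X <#>\<^bsub>S\<^esub> N"
      using set_multI[OF h norm[OF Xinv[OF h] g], of S] by simp
  qed
  moreover have "p_torsion S 2 (X <#>\<^bsub>S\<^esub> N)"
  proof -
    have "\<exists>e. (h \<otimes>\<^bsub>S\<^esub> g) [^]\<^bsub>S\<^esub> ((2::nat) ^ e) = \<one>\<^bsub>S\<^esub>" if "h \<in> X" "g \<in> N" for h g
      by (rule S.p_torsion_mult[OF X X_torsion N N_torsion _ that]) (simp add: norm XA)
    then show ?thesis
      unfolding p_torsion_def set_mult_def by blast
  qed
  moreover have "x \<in> X <#>\<^bsub>S\<^esub> N" "transpose a b \<in> X <#>\<^bsub>S\<^esub> N"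
  proof -
    have "x \<in> X"
      by (simp add: X_def generate.incl)
    then show "x \<in> X <#>\<^bsub>S\<^esub> N"
      using set_multI[of x X "id" N S] subgroup.one_closed[OF N] by simp
    have "\<phi> b = a"
      using invol \<phi>a by metis
    then have "transpose a b \<in> N"
      using \<phi>a ab by (auto simp: N_def permutes_swap_id transpose_def)
    then show "transpose a b \<in> X <#>\<^bsub>S\<^esub> N"
      using set_multI[of "id" X "transpose a b" N S] subgroup.one_closed[OF X] by simp
  qed
  ultimately show ?thesis
    using two_subgroup_subset_Sub by blast
qed

section \<open>The relation of linked points\<close>

definition linked :: "'a \<Rightarrow> 'a \<Rightarrow> bool" where
  "linked a b \<longleftrightarrow> transpose a b \<in> Sub"

lemma linked_refl: "linked a a"
  using subgroup.one_closed[OF Sub_subgroup] by (simp add: linked_def)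

lemma linked_sym: "linked a b \<Longrightarrow> linked b a"
  by (simp add: linked_def transpose_commute)

text \<open>Conjugating a transposition by \<open>g\<close> gives the transposition of the images
  under \<open>g\<close>.\<close>

lemma linked_image:
  assumes "g \<in> Sub" "linked a b"
  shows "linked (g a) (g b)"
proof -
  have bij: "bij g"
    using Sub_permutes[OF assms(1)] permutes_bij by blast
  have "g \<circ> transpose a b \<circ> Hilbert_Choice.inv g = transpose (g a) (g b)"
    using bij by (auto simp: fun_eq_iff transpose_def bij_is_inj bij_is_surj surj_f_inv_f inv_f_f
        bij_inv_eq_iff)
  then show ?thesis
    using assms Sub_comp Sub_inv by (metis linked_def)
qed

text \<open>For distinct points, conjugating the transposition of \<open>a\<close> and
  \<open>b\<close> by that of \<open>b\<close> and \<open>c\<close> gives that of \<open>a\<close>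
  and \<open>c\<close>.\<close>

lemma linked_trans:
  assumes "linked a b" "linked b c"
  shows "linked a c"
proof (cases "a = c \<or> b = c \<or> a = b")
  case True
  then show ?thesis
    using assms linked_refl by auto
next
  case False
  then have "transpose b c a = a" "transpose b c b = c"
    by (auto simp: transpose_def)
  then show ?thesis
    using linked_image[of "transpose b c" a b] assms by (simp add: linked_def)
qed

lemma Sub_eq_carrier:
  assumes "\<And>a b. a \<in> A \<Longrightarrow> b \<in> A \<Longrightarrow> linked a b"
  shows "Sub = carrier S"
proof
  show "Sub \<subseteq> carrier S"
    using Sub_subgroup by (rule subgroup.subset)
  have "p \<in> Sub" if "p permutes A" for p
    using that finite_A
  proof (induction rule: permutes_induct)
    case id
    then show ?case
      using subgroup.one_closed[OF Sub_subgroup] by (simp add: id_def)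
  next
    case (swap a b p)
    then show ?case
      using assms[of a b] Sub_comp unfolding linked_def by blast
  qed
  then show "carrier S \<subseteq> Sub"
    by auto
qed

end

text \<open>Discard a smallest term as long as the rest still sums to at least \<open>2^M\<close>.
  When this is no longer possible, the excess over \<open>2^M\<close> is smaller than the smallest
  term but divisible by it, hence zero.\<close>

lemma subset_sum_power_two:
  fixes f :: "'c \<Rightarrow> nat"
  assumes "finite T" "\<And>s. s \<in> T \<Longrightarrow> \<exists>e\<le>M. f s = 2 ^ e" "2 ^ M \<le> sum f T"
  obtains T' where "T' \<subseteq> T" "sum f T' = 2 ^ M"
proof -
  have "\<exists>T'\<subseteq>T. sum f T' = 2 ^ M"
    using assms
  proof (induction "card T" arbitrary: T)
    case 0
    then show ?case
      by simp
  next
    case (Suc k)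
    then have "T \<noteq> {}"
      by auto
    then obtain s where s: "s \<in> T" "\<And>t. t \<in> T \<Longrightarrow> f s \<le> f t"
      using Suc.prems(1) arg_min_if_finite[of T f] by (metis not_le)
    obtain e where e: "e \<le> M" "f s = 2 ^ e"
      using Suc.prems(2) s by blast
    have split: "sum f T = f s + sum f (T - {s})"
      using Suc.prems(1) s(1) by (simp add: sum.remove)
    show ?case
    proof (cases "2 ^ M \<le> sum f (T - {s})")
      case True
      have "\<exists>T'\<subseteq>T - {s}. sum f T' = 2 ^ M"
        using True Suc.prems Suc.hyps(2) s(1) by (intro Suc.hyps(1)) auto
      then show ?thesis
        by blast
    next
      case False
      have "2 ^ e dvd f t" if "t \<in> T" for t
      proof -
        obtain e' where e': "f t = 2 ^ e'"
          using Suc.prems(2) \<open>t \<in> T\<close> by blast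
        then have "e \<le> e'"
          using s(2)[OF \<open>t \<in> T\<close>] e by simp
        then show ?thesis
          using e' by (simp add: le_imp_power_dvd)
      qed
      then have "2 ^ e dvd sum f T"
        by (simp add: dvd_sum)
      moreover have "(2::nat) ^ e dvd 2 ^ M"
        using e by (simp add: le_imp_power_dvd)
      ultimately have "2 ^ e dvd sum f T - 2 ^ M"
        by (simp add: dvd_diff_nat)
      moreover have "sum f T - 2 ^ M < 2 ^ e"
        using False Suc.prems(3) split e by linarith
      ultimately have "sum f T - 2 ^ M = 0"
        by (meson dvd_imp_le neq0_conv not_le)
      then show ?thesis
        using Suc.prems(3) by auto
    qed
  qed
  then show ?thesis
    using that by blast
qed

section \<open>Cycles and linked points\<close>

context two_element
begin

abbreviation \<C> where "\<C> \<equiv> cycles_on x A"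

lemma finite_cycles: "finite \<C>"
  using finite_A by (simp add: cycles_on_def)

lemma cycle_eq_orbit:
  assumes "C \<in> \<C>" "c \<in> C"
  shows "C = orbit x c"
  using orbit_cyclic_eq3[OF cycles_on_cyclic[OF x_permutes finite_A assms(1)] assms(2)] by simp

lemma cycle_nonempty:
  assumes "C \<in> \<C>"
  shows "C \<noteq> {}"
  using cycles_on_cyclic[OF x_permutes finite_A assms] by (simp add: cyclic_on_alldef)

lemma cycle_closed:
  assumes "C \<in> \<C>" "c \<in> C"
  shows "x c \<in> C"
  using cyclic_on_inI[OF cycles_on_cyclic[OF x_permutes finite_A assms(1)] assms(2)] .

lemma cycle_subset:
  assumes "C \<in> \<C>"
  shows "C \<subseteq> A"
proof -
  obtain a where "a \<in> A" "C = orbit x a"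
    using assms unfolding cycles_on_def by (elim imageE) simp
  then show ?thesis
    using permutes_orbit_subset[OF x_permutes] by simp
qed

lemma orbit_in_cycles: "a \<in> A \<Longrightarrow> orbit x a \<in> \<C>"
  by (simp add: cycles_on_def)

lemma self_in_orbit: "a \<in> orbit x a"
  using permutation_x by (rule permutation_self_in_orbit)

lemma card_Union_cycles:
  assumes "T \<subseteq> \<C>"
  shows "card (\<Union>T) = sum card T"
proof (rule card_Union_disjoint)
  show "pairwise disjnt T"
    using assms cycles_on_disjoint[OF x_permutes finite_A] unfolding pairwise_def disjnt_def by blast
  show "finite C" if "C \<in> T" for C
    using that assms cycle_subset finite_subset[OF _ finite_A] by blast
qed

lemma Union_cycles: "\<Union>\<C> = A"
  using cycle_subset orbit_in_cycles self_in_orbit by blast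

lemma linked_equal_cycles:
  assumes CD: "C \<in> \<C>" "D \<in> \<C>" "C \<noteq> D" "card C = card D" and cd: "c \<in> C" "d \<in> D"
  shows "linked c d"
proof -
  have "C = orbit x c" "D = orbit x d"
    using cycle_eq_orbit CD cd by auto
  moreover have "C \<inter> D = {}"
    using cycles_on_disjoint[OF x_permutes finite_A CD(1-3)] .
  ultimately show ?thesis
    unfolding linked_def using CD cd cycle_subset by (intro transpose_equal_cycles_in_Sub) auto
qed

text \<open>For \<open>e = m t\<close> the complement in \<open>A\<close> is the set
  \<open>\<Omega>\<close> of the theorem.\<close>

definition points_below :: "nat \<Rightarrow> 'a set" where
  "points_below e = \<Union> {C \<in> \<C>. card C < 2 ^ e}"

text \<open>\<open>large\<close> is the failure of the criterion: at each cycle length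
  \<open>2^e\<close> other than the smallest, the shorter cycles cover at least \<open>2^e\<close>
  points. The bound \<open>f \<le> e\<close> in the exceptional case is what lets
  \<open>large\<close> force \<open>f = e\<close>. Each induction step adds the cycles of length
  exactly \<open>2^e\<close>.\<close>

lemma linked_points_below:
  assumes powers: "\<And>C. C \<in> \<C> \<Longrightarrow> \<exists>e. card C = 2 ^ e"
    and large: "\<And>e C. C \<in> \<C> \<Longrightarrow> card C = 2 ^ e \<Longrightarrow> points_below e \<noteq> {} \<Longrightarrow>
      2 ^ e \<le> card (points_below e)"
  shows "(\<forall>a\<in>points_below e. \<forall>b\<in>points_below e. linked a b) \<or>
    (\<exists>f\<le>e. card (points_below e) = 2 ^ f)"
proof (induction e)
  case 0
  have "points_below 0 = {}"
  proof -
    have "\<not> card C < 2 ^ 0" if "C \<in> \<C>" for C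
      using powers[OF that] by auto
    then show ?thesis
      unfolding points_below_def by blast
  qed
  then show ?case
    by simp
next
  case (Suc e)
  define V where "V = points_below e"
  define \<W> where "\<W> = {C \<in> \<C>. card C = 2 ^ e}"
  have finV: "finite V"
    using finite_A cycle_subset finite_subset[of V A] by (auto simp: V_def points_below_def)
  have "card C < 2 ^ Suc e \<longleftrightarrow> card C < 2 ^ e \<or> card C = 2 ^ e" if "C \<in> \<C>" for C
  proof -
    obtain f where "card C = 2 ^ f"
      using powers[OF \<open>C \<in> \<C>\<close>] by blast
    then show ?thesis
      by (auto simp: less_Suc_eq simp del: power_Suc)
  qed
  then have "{C \<in> \<C>. card C < 2 ^ Suc e} = {C \<in> \<C>. card C < 2 ^ e} \<union> \<W>"
    by (auto simp: \<W>_def)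
  then have step: "points_below (Suc e) = V \<union> \<Union>\<W>"
    by (simp add: points_below_def V_def Union_Un_distrib)
  have cards: "card (points_below (Suc e)) = card V + card (\<Union>\<W>)"
  proof -
    have "C \<inter> D = {}" if "C \<in> \<C>" "card C < 2 ^ e" "D \<in> \<W>" for C D
      using that cycles_on_disjoint[OF x_permutes finite_A, of C D] by (cases "C = D") (simp_all add: \<W>_def)
    then have "V \<inter> \<Union>\<W> = {}"
      unfolding V_def points_below_def by blast
    moreover have "finite (\<Union>\<W>)"
      using finite_A cycle_subset finite_subset[of "\<Union>\<W>" A] by (auto simp: \<W>_def)
    ultimately show ?thesis
      using finV step by (simp add: card_Un_disjoint)
  qed
  \<comment> \<open>With a second cycle at hand, even two points of the same cycle are linked,
    through any point of another one.\<close>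
  have linked_\<W>: "linked c d"
    if W: "C \<in> \<W>" "D \<in> \<W>" "C \<noteq> D" and cd: "c \<in> \<Union>\<W>" "d \<in> \<Union>\<W>" for C D c d
  proof -
    obtain C' D' where C'D': "C' \<in> \<W>" "c \<in> C'" "D' \<in> \<W>" "d \<in> D'"
      using cd by blast
    show ?thesis
    proof (cases "C' = D'")
      case False
      then show ?thesis
        using C'D' linked_equal_cycles[of C' D' c d] by (simp add: \<W>_def)
    next
      case True
      obtain E where E: "E \<in> \<W>" "E \<noteq> C'"
        using W by blast
      then obtain z where "z \<in> E"
        using cycle_nonempty by (fastforce simp: \<W>_def)
      then have "linked c z" "linked z d"
        using E C'D' True linked_equal_cycles[of C' E c z] linked_equal_cycles[of E C' z d]
        by (auto simp: \<W>_def)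
      then show ?thesis
        by (rule linked_trans)
    qed
  qed
  show ?case
  proof (cases "\<W> = {}")
    case True
    then have "points_below (Suc e) = V"
      using step by simp
    then show ?thesis
      using Suc.IH le_SucI unfolding V_def by metis
  next
    case False
    then obtain C where C: "C \<in> \<W>"
      by blast
    then have CC: "C \<in> \<C>" "card C = 2 ^ e"
      by (simp_all add: \<W>_def)
    show ?thesis
    proof (cases "V = {}")
      \<comment> \<open>The new cycles are the shortest: a single one has \<open>2^e\<close> points,
        the exceptional case, while the points of several are all linked.\<close>
      case V: True
      show ?thesis
      proof (cases "\<W> = {C}")
        case True
        then have "card (points_below (Suc e)) = 2 ^ e"
          using step V CC by simp
        then show ?thesis
          by (intro disjI2 exI[of _ e]) simp
      next
        case False
        then obtain D where "D \<in> \<W>" "C \<noteq> D"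
          using C by blast
        then show ?thesis
          using linked_\<W>[OF C] step V by simp
      qed
    next
      case V: False
      have le: "2 ^ e \<le> card V"
        using large[OF CC] V by (simp add: V_def)
      \<comment> \<open>\<open>f \<le> e\<close> and \<open>2^e \<le> card V\<close> leave only
        \<open>f = e\<close>.\<close>
      have IH: "(\<forall>a\<in>V. \<forall>b\<in>V. linked a b) \<or> card V = 2 ^ e"
      proof -
        have "card V = 2 ^ e" if "f \<le> e" "card V = 2 ^ f" for f
          using le that by (simp add: le_antisym)
        then show ?thesis
          using Suc.IH unfolding V_def by blast
      qed
      \<comment> \<open>Shorter cycles of total size exactly \<open>2^e\<close> are selected, so
        that together with \<open>C\<close> they form an invariant set of \<open>2^(e+1)\<close>
        points.\<close>
      define T where "T = {C \<in> \<C>. card C < 2 ^ e}"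
      have T: "T \<subseteq> \<C>" "finite T" "\<Union>T = V"
        using finite_cycles by (auto simp: T_def V_def points_below_def)
      have "\<exists>f\<le>e. card D = 2 ^ f" if "D \<in> T" for D
      proof -
        obtain f where f: "card D = 2 ^ f"
          using powers[of D] \<open>D \<in> T\<close> T(1) by blast
        then have "f \<le> e"
          using \<open>D \<in> T\<close> by (simp add: T_def)
        then show ?thesis
          using f by blast
      qed
      moreover have "2 ^ e \<le> sum card T"
        using le card_Union_cycles[OF T(1)] T(3) by simp
      ultimately obtain T' where T': "T' \<subseteq> T" "sum card T' = 2 ^ e"
        using subset_sum_power_two[OF T(2), of e card] by metis
      define E where "E = \<Union>T'"
      have EV: "E \<subseteq> V"
        using T' T by (auto simp: E_def)
      have E: "card E = 2 ^ e"
        unfolding E_def using card_Union_cycles[of T'] T' T by auto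
      have below_disjoint: "v \<notin> D" if "v \<in> V" "D \<in> \<W>" for v D
      proof
        assume "v \<in> D"
        moreover obtain F where "F \<in> T" "v \<in> F"
          using T(3) \<open>v \<in> V\<close> by blast
        ultimately show False
          using cycle_eq_orbit[of F v] cycle_eq_orbit[of D v] \<open>D \<in> \<W>\<close> by (simp add: T_def \<W>_def)
      qed
      have "C \<inter> E = {}"
        using below_disjoint C EV by blast
      moreover have "finite E" "finite C"
        using EV finV finite_subset cycle_subset[OF CC(1)] finite_A by blast+
      ultimately have card_CE: "card (C \<union> E) = 2 ^ Suc e"
        using E CC by (simp add: card_Un_disjoint)
      have CE: "C \<union> E \<subseteq> A" "\<And>d. d \<in> C \<union> E \<Longrightarrow> x d \<in> C \<union> E"
        using CC(1) T' T cycle_subset cycle_closed unfolding E_def by blast+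
      \<comment> \<open>An element moving \<open>c\<close> to \<open>d\<close> inside
        \<open>C \<union> E\<close> fixes \<open>u\<close> outside, so a link with \<open>u\<close>
        passes from one point of this set to all others.\<close>
      have transport: "linked d u"
        if c: "c \<in> C \<union> E" and d: "d \<in> C \<union> E" and u: "u \<notin> C \<union> E" and cu: "linked c u" for c d u
      proof -
        obtain g where g: "g \<in> Sub" "g permutes C \<union> E" "g c = d"
          using Sub_moves_in_invariant_set[OF CE card_CE c d] by blast
        then show ?thesis
          using linked_image[OF g(1) cu] permutes_not_in[OF g(2) u] by simp
      qed
      have "E \<noteq> {}"
        using E by auto
      then obtain e\<^sub>0 where e0: "e\<^sub>0 \<in> E"
        by blast
      obtain c\<^sub>0 where c0: "c\<^sub>0 \<in> C"
        using cycle_nonempty[OF CC(1)] by blast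
      show ?thesis
      proof (cases "\<W> = {C}")
        \<comment> \<open>With \<open>C\<close> the only new cycle, a link leaving
          \<open>C \<union> E\<close> has to come from a point of \<open>V\<close> outside
          \<open>E\<close>. There is none exactly if \<open>V = E\<close>, and then
          \<open>2^(e+1)\<close> points are covered.\<close>
        case True
        show ?thesis
        proof (cases "card V = 2 ^ e")
          case True
          then have "card (points_below (Suc e)) = 2 ^ Suc e"
            using cards \<open>\<W> = {C}\<close> CC by simp
          then show ?thesis
            by blast
        next
          case False
          then have VV: "\<forall>a\<in>V. \<forall>b\<in>V. linked a b"
            using IH by blast
          have "E \<noteq> V"
            using False E by blast
          then obtain u where u: "u \<in> V" "u \<notin> E"
            using EV by blast
          have "u \<notin> C"
            using below_disjoint u(1) C by blast
          \<comment> \<open>\<open>e\<^sub>0\<close> and \<open>u\<close> both lie in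
            \<open>V\<close>, hence are linked; this link is transported to
            \<open>C\<close>.\<close>
          then have Cu: "linked c u" if "c \<in> C \<union> V" for c
            using transport[of e\<^sub>0 c u] e0 EV u VV that by auto
          have "linked a b" if "a \<in> C \<union> V" "b \<in> C \<union> V" for a b
            using Cu[OF that(1)] linked_sym[OF Cu[OF that(2)]] by (rule linked_trans)
          then show ?thesis
            using step \<open>\<W> = {C}\<close> by auto
        qed
      next
        case False
        then obtain D where D: "D \<in> \<W>" "C \<noteq> D"
          using C by blast
        then obtain d\<^sub>0 where d0: "d\<^sub>0 \<in> D"
          using cycle_nonempty by (fastforce simp: \<W>_def)
        have "C \<inter> D = {}"
          using cycles_on_disjoint[OF x_permutes finite_A CC(1)] D by (simp add: \<W>_def)
        then have "d\<^sub>0 \<notin> C \<union> E"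
          using below_disjoint D(1) d0 EV by blast
        \<comment> \<open>\<open>c\<^sub>0\<close> and \<open>d\<^sub>0\<close> lie on distinct
          cycles of equal length; their link is transported from \<open>C\<close> to
          \<open>E\<close>.\<close>
        then have Ed: "linked v d\<^sub>0" if "v \<in> E" for v
          using transport[of c\<^sub>0 v d\<^sub>0] c0 that linked_\<W>[OF C D, of c\<^sub>0 d\<^sub>0] C D d0 by blast
        \<comment> \<open>In the exceptional case \<open>V\<close> coincides with \<open>E\<close>;
          otherwise every point of \<open>V\<close> is linked to \<open>e\<^sub>0\<close> in
          \<open>E\<close>.\<close>
        have "linked v d\<^sub>0" if v: "v \<in> V" for v
        proof (cases "card V = 2 ^ e")
          case True
          then have "E = V"
            using EV E finV by (simp add: card_subset_eq)
          then show ?thesis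
            using Ed v by simp
        next
          case False
          then have "linked v e\<^sub>0"
            using IH v e0 EV by blast
          then show ?thesis
            using Ed[OF e0] by (rule linked_trans)
        qed
        moreover have "linked w d\<^sub>0" if "w \<in> \<Union>\<W>" for w
          using linked_\<W>[OF C D that] D d0 by blast
        ultimately have all: "linked v d\<^sub>0" if "v \<in> V \<union> \<Union>\<W>" for v
          using that by blast
        have "linked a b" if "a \<in> V \<union> \<Union>\<W>" "b \<in> V \<union> \<Union>\<W>" for a b
          using all[OF that(1)] linked_sym[OF all[OF that(2)]] by (rule linked_trans)
        then show ?thesis
          using step by auto
      qed
    qed
  qed
qed

text \<open>Every cycle is shorter than \<open>2 ^ card A\<close>, so at the exponent
  \<open>card A\<close> the set \<open>points_below\<close> is all of \<open>A\<close>, and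
  \<open>not_power\<close> rules out the exceptional case.\<close>

lemma Sub_eq_carrier_of_large_below:
  assumes "\<And>C. C \<in> \<C> \<Longrightarrow> \<exists>e. card C = 2 ^ e"
    and "\<And>e C. C \<in> \<C> \<Longrightarrow> card C = 2 ^ e \<Longrightarrow> points_below e \<noteq> {} \<Longrightarrow>
      2 ^ e \<le> card (points_below e)"
    and not_power: "\<nexists>e. card A = 2 ^ e"
  shows "Sub = carrier S"
proof -
  have "card C < 2 ^ card A" if "C \<in> \<C>" for C
  proof -
    have "card C \<le> card A"
      using cycle_subset[OF that] finite_A by (rule card_mono[rotated])
    then show ?thesis
      using less_exp le_less_trans by blast
  qed
  then have "points_below (card A) = A"
    unfolding points_below_def using Union_cycles by blast
  then show ?thesis
    using linked_points_below[of "card A"] assms by (intro Sub_eq_carrier) auto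
qed

end

section \<open>Subnormality preserves the long cycles\<close>

lemma (in group) subnormal_supergroup:
  assumes M: "subgroup M G" and "subnormal (G\<lparr>carrier := M\<rparr>) H K"
  shows "subnormal G H K"
  using assms(2)
proof (induction rule: subnormal.induct)
  case (refl K)
  then show ?case
    using incl_subgroup[OF M] by (simp add: subnormal.refl)
next
  case (step L K H)
  then show ?case
    by (auto intro: subnormal.step)
qed

lemma (in group) subnormal_generate_image:
  assumes G': "group G'" and f: "f \<in> hom (G\<lparr>carrier := M\<rparr>) G'" and M: "subgroup M G"
    and x: "x \<in> M" and g: "g \<in> M" and sub: "subnormal G (generate G {x}) (generate G {x, g})"
  shows "subnormal G' (generate G' {f x}) (generate G' {f x, f g})"
proof -
  interpret f: group_hom "G\<lparr>carrier := M\<rparr>" G' f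
    using f subgroup_imp_group[OF M] G' by (simp add: group_hom_def group_hom_axioms_def)
  have img: "f ` generate G T = generate G' (f ` T)" if "T \<subseteq> M" for T
    using f.generate_img[of T] generate_consistent[OF that M] that by simp
  have "generate G {x, g} \<subseteq> M"
    using x g M by (simp add: generate_subgroup_incl)
  then have "subnormal G' (f ` generate G {x}) (f ` generate G {x, g})"
    by (rule subnormal_image[OF G' f M sub])
  then show ?thesis
    using x g by (simp add: img)
qed

context two_element
begin

section \<open>Splitting along an invariant set\<close>

definition preserving :: "'a set \<Rightarrow> ('a \<Rightarrow> 'a) set" where
  "preserving B = {g. g permutes A \<and> (\<forall>p\<in>B. g p \<in> B)}"

lemma preserving_subgroup:
  assumes "B \<subseteq> A"
  shows "subgroup (preserving B) S"
proof (rule S.subgroupI)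
  show "preserving B \<subseteq> carrier S"
    by (auto simp: preserving_def)
  show "preserving B \<noteq> {}"
    using permutes_id[of A] by (auto simp: preserving_def intro!: exI[of _ id])
  show "g \<otimes>\<^bsub>S\<^esub> h \<in> preserving B" if "g \<in> preserving B" "h \<in> preserving B" for g h
    using that by (auto simp: preserving_def permutes_compose)
  show "inv\<^bsub>S\<^esub> g \<in> preserving B" if g: "g \<in> preserving B" for g
  proof -
    have gA: "g permutes A" and gB: "\<And>p. p \<in> B \<Longrightarrow> g p \<in> B"
      using g by (auto simp: preserving_def)
    \<comment> \<open>Preservation is stated as an inclusion; finiteness of \<open>B\<close> makes
      it an equality, which gives inverses.\<close>
    have "finite B"
      using assms finite_A finite_subset by blast
    then have "g ` B = B"
      using gB permutes_inj[OF gA] by (intro endo_inj_surj) (auto simp: inj_on_def inj_def)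
    then have "Hilbert_Choice.inv g p \<in> B" if "p \<in> B" for p
      using that permutes_inverses(2)[OF gA] by (metis imageE)
    then show ?thesis
      using gA by (simp add: preserving_def permutes_inv)
  qed
qed

lemma perm_restrict_hom:
  assumes "B \<subseteq> A"
  shows "(\<lambda>g. perm_restrict g B) \<in> hom (S\<lparr>carrier := preserving B\<rparr>) (sym_group_on B)"
proof -
  have "finite B"
    using assms finite_A finite_subset by blast
  then show ?thesis
    by (auto simp: hom_def preserving_def fun_eq_iff perm_restrict_simps(1) intro!: perm_restrict_permutes)
      (auto simp: perm_restrict_def)
qed

text \<open>Restriction to \<open>B\<close> is a homomorphism on \<open>preserving B\<close>, so it
  carries the subnormal chain for \<open>g\<close> to one for the restrictions.\<close>

lemma restrict_mem_subnormalizer: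
  assumes B: "B \<subseteq> A" and x: "x \<in> preserving B" and g: "g \<in> preserving B"
    and sub: "subnormal S (generate S {x}) (generate S {x, g})"
  shows "perm_restrict g B \<in> subnormalizer (sym_group_on B) (perm_restrict x B)"
proof -
  have "finite B"
    using B finite_A finite_subset by blast
  then have "perm_restrict g B permutes B"
    using g by (intro perm_restrict_permutes[of g A]) (auto simp: preserving_def)
  then show ?thesis
    using S.subnormal_generate_image[OF group_sym_group_on perm_restrict_hom[OF B] preserving_subgroup[OF B] x g sub]
    by (intro group.mem_subnormalizerI[OF group_sym_group_on]) simp_all
qed

lemma preserving_complement:
  assumes "B \<subseteq> A" "g \<in> preserving B"
  shows "g \<in> preserving (A - B)"
proof -
  have "finite B"
    using assms(1) finite_A finite_subset by blast
  then show ?thesis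
    using assms finite_invariant_complement[of g A B] by (simp add: preserving_def)
qed

text \<open>A generator on the left moves only points of \<open>B\<close>, so it commutes with the
  restriction of \<open>x\<close> to the complement; \<open>subnormal_commuting_factor\<close> then
  makes it a generator of \<open>Sub\<close>.\<close>

lemma subnormalizer_restrict_subset:
  assumes B: "B \<subseteq> A" and x: "x \<in> preserving B"
  shows "subnormalizer (sym_group_on B) (perm_restrict x B) \<subseteq> Sub"
proof -
  define y where "y = perm_restrict x B"
  define z where "z = perm_restrict x (A - B)"
  have fin: "finite B" "finite (A - B)"
    using B finite_A finite_subset by blast+
  have xB: "\<And>p. p \<in> B \<Longrightarrow> x p \<in> B" and xc: "\<And>p. p \<in> A - B \<Longrightarrow> x p \<in> A - B"
    using x preserving_complement[OF B x] by (auto simp: preserving_def)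
  have y: "y permutes B" and z: "z permutes (A - B)"
    unfolding y_def z_def using perm_restrict_permutes[OF x_permutes] fin xB xc by blast+
  have yz: "y \<otimes>\<^bsub>S\<^esub> z = x"
    using perm_restrict_split[OF x_permutes B xB xc] by (simp add: y_def z_def)
  note SB = sym_group_on_subgroup[OF B]
  define T where "T = {g \<in> carrier (sym_group_on B).
    subnormal (sym_group_on B) (generate (sym_group_on B) {y}) (generate (sym_group_on B) {y, g})}"
  have "g \<in> Sub" if g: "g \<in> T" for g
  proof -
    have gB: "g permutes B"
      using g by (simp add: T_def)
    have carr: "y \<in> carrier S" "z \<in> carrier S" "g \<in> carrier S"
      using y z gB B by (auto intro: permutes_subset)
    have gen: "generate (sym_group_on B) U = generate S U" if "U \<subseteq> {p. p permutes B}" for U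
      unfolding SB(2) by (rule S.generate_consistent[OF that SB(1)])
    have "subnormal (sym_group_on B) (generate S {y}) (generate S {y, g})"
      using g gen[of "{y}"] gen[of "{y, g}"] y gB by (simp add: T_def)
    then have "subnormal S (generate S {y}) (generate S {y, g})"
      unfolding SB(2) by (rule S.subnormal_supergroup[OF SB(1)])
    then have "subnormal S (generate S {y \<otimes>\<^bsub>S\<^esub> z}) (generate S {y \<otimes>\<^bsub>S\<^esub> z, g})"
      using permutes_disjoint_commute[OF y z] permutes_disjoint_commute[OF gB z] carr
      by (intro S.subnormal_commuting_factor) auto
    then show ?thesis
      using yz carr(3) by (simp add: S.mem_subnormalizerI)
  qed
  moreover have "generate (sym_group_on B) T = generate S T"
    unfolding SB(2) by (rule S.generate_consistent[OF _ SB(1)]) (auto simp: T_def)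
  ultimately have "generate (sym_group_on B) T \<subseteq> Sub"
    using S.generate_subgroup_incl[OF _ Sub_subgroup, of T] by auto
  then show ?thesis
    by (simp add: subnormalizer_def T_def y_def)
qed

text \<open>Each generator preserves \<open>B\<close>, so it is the product of its restrictions to
  \<open>B\<close> and to the complement, and these lie in the two subnormalizers. Conversely, both
  factors lie in \<open>Sub\<close> by \<open>subnormalizer_restrict_subset\<close>.\<close>

lemma Sub_eq_product:
  assumes B: "B \<subseteq> A" and x: "x \<in> preserving B"
    and pres: "\<And>g. g \<in> carrier S \<Longrightarrow> subnormal S (generate S {x}) (generate S {x, g}) \<Longrightarrow>
      g \<in> preserving B"
  shows "Sub = subnormalizer (sym_group_on B) (perm_restrict x B) <#>\<^bsub>S\<^esub>
    subnormalizer (sym_group_on (A - B)) (perm_restrict x (A - B))" (is "Sub = ?Y <#>\<^bsub>S\<^esub> ?Z")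
proof
  have AB: "A - B \<subseteq> A"
    by blast
  note SB = sym_group_on_subgroup[OF B] and SAB = sym_group_on_subgroup[OF AB]
  have YB: "subgroup ?Y (sym_group_on B)" and ZB: "subgroup ?Z (sym_group_on (A - B))"
    by (rule subnormalizer_is_subgroup, rule group_sym_group_on)+
  have Y: "subgroup ?Y S" and Z: "subgroup ?Z S"
    using S.incl_subgroup[OF SB(1)] S.incl_subgroup[OF SAB(1)] YB ZB unfolding SB(2) SAB(2) by blast+
  have "subgroup (?Y <#>\<^bsub>S\<^esub> ?Z) S"
  proof (rule S.set_mult_subgroup[OF Y Z])
    fix h k assume hk: "h \<in> ?Y" "k \<in> ?Z"
    then have "h permutes B" "k permutes (A - B)"
      using subgroup.mem_carrier[OF YB] subgroup.mem_carrier[OF ZB] by simp_all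
    then have "k \<circ> h = h \<circ> k"
      using permutes_disjoint_commute[of h B k "A - B"] by simp
    then show "k \<otimes>\<^bsub>S\<^esub> h \<in> ?Y <#>\<^bsub>S\<^esub> ?Z"
      using set_multI[OF hk, of S] by simp
  qed
  moreover have "g \<in> ?Y <#>\<^bsub>S\<^esub> ?Z"
    if g: "g \<in> carrier S" "subnormal S (generate S {x}) (generate S {x, g})" for g
  proof -
    have gB: "g \<in> preserving B" "g \<in> preserving (A - B)"
      using pres[OF g] preserving_complement[OF B] by auto
    have "perm_restrict g B \<in> ?Y" "perm_restrict g (A - B) \<in> ?Z"
      using restrict_mem_subnormalizer[OF B x gB(1) g(2)]
        restrict_mem_subnormalizer[OF AB preserving_complement[OF B x] gB(2) g(2)] .
    moreover have "perm_restrict g B \<circ> perm_restrict g (A - B) = g"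
      using gB g(1) B by (intro perm_restrict_split) (auto simp: preserving_def)
    ultimately show ?thesis
      using set_multI[of "perm_restrict g B" ?Y "perm_restrict g (A - B)" ?Z S] by simp
  qed
  ultimately show "Sub \<subseteq> ?Y <#>\<^bsub>S\<^esub> ?Z"
    unfolding subnormalizer_def[of S x] by (intro S.generate_subgroup_incl) auto
  have "?Y \<subseteq> Sub" "?Z \<subseteq> Sub"
    using subnormalizer_restrict_subset[OF B x] subnormalizer_restrict_subset[OF AB preserving_complement[OF B x]] .
  then show "?Y <#>\<^bsub>S\<^esub> ?Z \<subseteq> Sub"
    using Sub_comp by (auto simp: set_mult_def)
qed

section \<open>Orbits of a normal 2-subgroup\<close>

lemma funpow_mem_subgroup:
  assumes "subgroup Q S" "x \<in> Q"
  shows "x ^^ k \<in> Q"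
proof (induction k)
  case 0
  then show ?case
    using subgroup.one_closed[OF assms(1)] by (simp add: id_def)
next
  case (Suc k)
  then have "x \<circ> x ^^ k \<in> Q"
    using subgroup.m_closed[OF assms, of "x ^^ k"] by simp
  then show ?case
    by (simp only: funpow.simps)
qed

text \<open>Subnormality yields a normal 2-subgroup \<open>Q\<close> containing \<open>x\<close>.
  Its orbits have 2-power size and are unions of cycles of \<open>x\<close>; the contradiction comes
  from counting the points of one orbit on long and on short cycles.\<close>

lemma preserving_long_cycles:
  assumes powers: "\<And>C. C \<in> \<C> \<Longrightarrow> \<exists>e. card C = 2 ^ e"
    and small: "card (points_below e) < 2 ^ e"
    and g: "g \<in> carrier S" and sub: "subnormal S (generate S {x}) (generate S {x, g})"
  shows "g \<in> preserving (A - points_below e)"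
proof -
  define \<Omega> where "\<Omega> = A - points_below e"
  define K where "K = generate S {x, g}"
  have K: "subgroup K S"
    unfolding K_def using g x_permutes by (intro S.generate_is_subgroup) auto
  obtain Q where Q: "Q \<lhd> S\<lparr>carrier := K\<rparr>" "p_torsion S 2 Q" "generate S {x} \<subseteq> Q"
    using S.subnormal_p_torsion[OF sub p_torsion_generate_x] unfolding K_def by blast
  have QS: "subgroup Q S" and QK: "\<And>a h. a \<in> K \<Longrightarrow> h \<in> Q \<Longrightarrow> a \<otimes>\<^bsub>S\<^esub> h \<otimes>\<^bsub>S\<^esub> inv\<^bsub>S\<^esub> a \<in> Q"
    using Q(1) S.normal_in_subgroup_iff[OF K] by auto
  have xQ: "x \<in> Q"
    using Q(3) by (auto intro: generate.incl)
  have QA: "h permutes A" if "h \<in> Q" for h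
    using subgroup.mem_carrier[OF QS that] by simp
  have finQ: "finite Q"
    using subgroup.subset[OF QS] finite_sym_group_on[OF finite_A] finite_subset by blast
  interpret Q: group "S\<lparr>carrier := Q\<rparr>"
    by (rule S.subgroup_imp_group[OF QS])
  obtain k where k: "card Q = 2 ^ k"
    using S.card_p_torsion[OF finite_sym_group_on[OF finite_A] two_is_prime_nat QS Q(2)] by blast
  define O' where "O' q = (\<lambda>h. h q) ` Q" for q
  have self: "q \<in> O' q" for q
    using subgroup.one_closed[OF QS] image_eqI[of q "\<lambda>h. h q" id Q] by (simp add: O'_def)
  have "g p \<in> \<Omega>" if p: "p \<in> \<Omega>" for p
  proof (rule ccontr)
    define q where "q = g p"
    assume "g p \<notin> \<Omega>"
    then have q: "q \<in> points_below e"
      using p g permutes_in_image[of g A p] by (simp add: q_def \<Omega>_def)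
    have OA: "O' p \<subseteq> A" "O' q \<subseteq> A"
      using QA p g permutes_in_image[of _ A] by (auto simp: O'_def q_def \<Omega>_def)
    have finO: "finite (O' p)" "finite (O' q)"
      using OA finite_A finite_subset by blast+
    have "card (O' q) * card {h \<in> Q. h q = q} = 2 ^ k"
      using Q.card_orbit_times_stabilizer[of "\<lambda>h. h" q] finQ k by (simp add: O'_def order_def)
    then have "card (O' q) dvd 2 ^ k"
      by (rule dvdI[OF sym])
    then obtain j where j: "card (O' q) = 2 ^ j"
      using divides_primepow_nat[OF two_is_prime_nat] by blast
    \<comment> \<open>Because \<open>g\<close> normalizes \<open>Q\<close>, it carries the orbit of
      \<open>p\<close> into the orbit of \<open>q\<close>.\<close>
    have "g ` O' p \<subseteq> O' q"
    proof
      fix w assume "w \<in> g ` O' p"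
      then obtain h where h: "h \<in> Q" "w = g (h p)"
        by (auto simp: O'_def)
      have "g \<circ> h \<circ> Hilbert_Choice.inv g \<in> Q"
        using QK[of g h] h(1) g by (simp add: K_def generate.incl)
      moreover have "(g \<circ> h \<circ> Hilbert_Choice.inv g) q = w"
        using g h(2) permutes_inverses(2)[of g A] by (simp add: q_def)
      ultimately show "w \<in> O' q"
        unfolding O'_def by (metis image_eqI)
    qed
    then have "card (O' p) \<le> card (O' q)"
      using finO g permutes_inj[of g A] by (intro card_inj_on_le[of g]) (auto simp: inj_on_def inj_def)
    \<comment> \<open>Since \<open>x\<close> lies in \<open>Q\<close>, the orbit contains the whole
      cycle through \<open>p\<close>, which is long.\<close>
    moreover have "card (orbit x p) \<le> card (O' p)"
    proof (rule card_mono[OF finO(1)])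
      show "orbit x p \<subseteq> O' p"
        using funpow_mem_subgroup[OF QS xQ] unfolding O'_def orbit_altdef_permutation[OF permutation_x] by blast
    qed
    moreover have "2 ^ e \<le> card (orbit x p)"
    proof (rule ccontr)
      assume "\<not> ?thesis"
      then have "p \<in> points_below e"
        using p orbit_in_cycles[of p] self_in_orbit[of p] by (auto simp: points_below_def \<Omega>_def)
      then show False
        using p by (simp add: \<Omega>_def)
    qed
    \<comment> \<open>Between powers of 2 an inequality upgrades to divisibility.\<close>
    ultimately have "(2::nat) ^ e \<le> 2 ^ j"
      unfolding j by linarith
    then have dvd_orbit: "2 ^ e dvd card (O' q)"
      unfolding j by (simp add: le_imp_power_dvd)
    \<comment> \<open>The orbit of \<open>q\<close> is a union of cycles; \<open>T\<close> collects
      its long ones, whose lengths are multiples of \<open>2^e\<close>.\<close>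
    define T where "T = {C \<in> \<C>. C \<subseteq> O' q \<and> 2 ^ e \<le> card C}"
    have xO: "x c \<in> O' q" if c: "c \<in> O' q" for c
    proof -
      obtain h where h: "h \<in> Q" "c = h q"
        using c by (auto simp: O'_def)
      then have "x \<circ> h \<in> Q"
        using subgroup.m_closed[OF QS xQ, of h] by simp
      then show ?thesis
        using h unfolding O'_def by (intro image_eqI[of _ _ "x \<circ> h"]) auto
    qed
    have orbO: "orbit x c \<subseteq> O' q" if c: "c \<in> O' q" for c
    proof
      fix w assume "w \<in> orbit x c"
      then show "w \<in> O' q"
        by induction (use xO c in auto)
    qed
    have "\<Union>T = O' q \<inter> \<Omega>"
    proof
      show "\<Union>T \<subseteq> O' q \<inter> \<Omega>"
      proof
        fix c assume "c \<in> \<Union>T"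
        then obtain C where C: "C \<in> \<C>" "C \<subseteq> O' q" "2 ^ e \<le> card C" "c \<in> C"
          by (auto simp: T_def)
        have "c \<notin> points_below e"
        proof
          assume "c \<in> points_below e"
          then obtain D where "D \<in> \<C>" "card D < 2 ^ e" "c \<in> D"
            by (auto simp: points_below_def)
          then show False
            using C cycle_eq_orbit[of C c] cycle_eq_orbit[of D c] by simp
        qed
        then show "c \<in> O' q \<inter> \<Omega>"
          using C OA(2) by (auto simp: \<Omega>_def)
      qed
      show "O' q \<inter> \<Omega> \<subseteq> \<Union>T"
      proof
        fix c assume c: "c \<in> O' q \<inter> \<Omega>"
        then have cA: "c \<in> A" "c \<notin> points_below e"
          by (simp_all add: \<Omega>_def)
        then have "2 ^ e \<le> card (orbit x c)"
          using orbit_in_cycles[of c] self_in_orbit[of c] by (force simp: points_below_def not_less)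
        then have "orbit x c \<in> T"
          using c cA orbO orbit_in_cycles by (simp add: T_def)
        then show "c \<in> \<Union>T"
          using self_in_orbit[of c] by blast
      qed
    qed
    moreover have "2 ^ e dvd card (\<Union>T)"
    proof -
      have "2 ^ e dvd card C" if C: "C \<in> T" for C
      proof -
        obtain f where "card C = 2 ^ f"
          using powers[of C] C by (auto simp: T_def)
        then show ?thesis
          using C by (simp add: T_def le_imp_power_dvd)
      qed
      moreover have "card (\<Union>T) = sum card T"
        by (rule card_Union_cycles) (auto simp: T_def)
      ultimately show ?thesis
        by (simp add: dvd_sum)
    qed
    ultimately have "2 ^ e dvd card (O' q \<inter> \<Omega>)"
      by simp
    moreover have "card (O' q) = card (O' q \<inter> \<Omega>) + card (O' q - \<Omega>)"
      using finO(2) by (simp add: card_Int_Diff)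
    ultimately have "2 ^ e dvd card (O' q - \<Omega>)"
      using dvd_orbit by (simp add: dvd_add_right_iff)
    moreover have "card (O' q - \<Omega>) < 2 ^ e"
    proof -
      have "O' q - \<Omega> \<subseteq> points_below e" "points_below e \<subseteq> A"
        using OA(2) cycle_subset by (auto simp: \<Omega>_def points_below_def)
      then have "card (O' q - \<Omega>) \<le> card (points_below e)"
        using finite_A finite_subset by (blast intro: card_mono)
      then show ?thesis
        using small by simp
    qed
    ultimately have "card (O' q - \<Omega>) = 0"
      by (meson dvd_imp_le neq0_conv not_le)
    \<comment> \<open>\<open>q\<close> itself is a point of its orbit outside
      \<open>\<Omega>\<close>.\<close>
    then show False
      using self[of q] q finO(2) by (auto simp: \<Omega>_def)
  qed
  then show ?thesis
    using g by (simp add: preserving_def \<Omega>_def)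
qed

end

section \<open>The subnormalizer of a 2-element\<close>

lemma (in two_element) card_Union_cycles_of_sizes:
  assumes I: "finite I" "inj_on m I"
    and l: "\<And>i. i \<in> I \<Longrightarrow> card {C \<in> \<C>. card C = 2 ^ m i} = l i"
  shows "card (\<Union> {C \<in> \<C>. \<exists>i\<in>I. card C = 2 ^ m i}) = (\<Sum>i\<in>I. l i * 2 ^ m i)"
proof -
  have split: "{C \<in> \<C>. \<exists>i\<in>I. card C = 2 ^ m i} = (\<Union>i\<in>I. {C \<in> \<C>. card C = 2 ^ m i})"
    by blast
  have "card (\<Union> {C \<in> \<C>. \<exists>i\<in>I. card C = 2 ^ m i}) = sum card {C \<in> \<C>. \<exists>i\<in>I. card C = 2 ^ m i}"
    by (rule card_Union_cycles) blast
  also have "\<dots> = (\<Sum>i\<in>I. \<Sum>C\<in>{C \<in> \<C>. card C = 2 ^ m i}. card C)"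
    unfolding split
    by (rule sum.UNION_disjoint) (use I finite_cycles in \<open>auto simp: inj_on_def\<close>)
  also have "\<dots> = (\<Sum>i\<in>I. l i * 2 ^ m i)"
    using l by (intro sum.cong) auto
  finally show ?thesis .
qed

lemma (in two_element) points_below_subset: "points_below e \<subseteq> A"
  using cycle_subset by (auto simp: points_below_def)

lemma (in two_element) Union_long_cycles: "\<Union> {C \<in> \<C>. 2 ^ e \<le> card C} = A - points_below e"
proof
  show "A - points_below e \<subseteq> \<Union> {C \<in> \<C>. 2 ^ e \<le> card C}"
  proof
    fix c assume c: "c \<in> A - points_below e"
    then obtain C where C: "C \<in> \<C>" "c \<in> C"
      using Union_cycles by blast
    then have "\<not> card C < 2 ^ e"
      using c unfolding points_below_def by blast
    then show "c \<in> \<Union> {C \<in> \<C>. 2 ^ e \<le> card C}"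
      using C by auto
  qed
  show "\<Union> {C \<in> \<C>. 2 ^ e \<le> card C} \<subseteq> A - points_below e"
  proof
    fix c assume "c \<in> \<Union> {C \<in> \<C>. 2 ^ e \<le> card C}"
    then obtain C where C: "C \<in> \<C>" "2 ^ e \<le> card C" "c \<in> C"
      by blast
    have "\<not> card D < 2 ^ e" if "D \<in> \<C>" "c \<in> D" for D
      using cycle_eq_orbit[OF that] cycle_eq_orbit[OF C(1,3)] C(2) by simp
    then have "c \<notin> points_below e"
      unfolding points_below_def by blast
    then show "c \<in> A - points_below e"
      using C cycle_subset by blast
  qed
qed

context two_element
begin

context
  fixes e :: nat
  assumes powers: "\<And>C. C \<in> \<C> \<Longrightarrow> \<exists>e. card C = 2 ^ e"
    and small: "card (points_below e) < 2 ^ e"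
begin

lemma Sub_subset_preserving: "Sub \<subseteq> preserving (A - points_below e)"
  unfolding subnormalizer_def
proof (rule S.generate_subgroup_incl[OF _ preserving_subgroup])
  show "{g \<in> carrier S. subnormal S (generate S {x}) (generate S {x, g})} \<subseteq>
      preserving (A - points_below e)"
    using preserving_long_cycles[OF powers small] by blast
qed blast

lemma Sub_eq_long_times_short:
  "Sub = subnormalizer (sym_group_on (A - points_below e)) (perm_restrict x (A - points_below e))
    <#>\<^bsub>S\<^esub> subnormalizer (sym_group_on (points_below e)) (perm_restrict x (points_below e))"
proof -
  define B where "B = A - points_below e"
  have B: "B \<subseteq> A" "A - B = points_below e"
    using points_below_subset by (auto simp: B_def)
  have pres: "g \<in> preserving B"
    if "g \<in> carrier S" "subnormal S (generate S {x}) (generate S {x, g})" for g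
    unfolding B_def by (rule preserving_long_cycles[OF powers small that])
  \<comment> \<open>\<open>x\<close> is itself one of the generators: for \<open>g = x\<close> both
    generated subgroups coincide.\<close>
  have "x \<in> preserving B"
    using x_permutes by (intro pres) (simp_all add: subnormal.refl S.generate_is_subgroup)
  then show ?thesis
    using Sub_eq_product[OF B(1) _ pres] unfolding B(2) B_def[symmetric] by blast
qed

text \<open>The transposition of a point on a long cycle and a point on a short one does not
  preserve the union of the long cycles.\<close>

lemma Sub_proper:
  assumes C: "C \<in> \<C>" "2 ^ e \<le> card C" and D: "D \<in> \<C>" "card D < 2 ^ e"
  shows "Sub \<subset> carrier S"
proof -
  obtain c d where c: "c \<in> C" and d: "d \<in> D"
    using cycle_nonempty C D by blast
  have d_below: "d \<in> points_below e"
    using D d by (auto simp: points_below_def)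
  have c_above: "c \<in> A - points_below e"
    using C c Union_long_cycles[of e] by auto
  have "transpose c d \<notin> preserving (A - points_below e)"
    using c_above d_below by (auto simp: preserving_def intro!: bexI[of _ c])
  moreover have "transpose c d \<in> carrier S"
    using c_above d_below points_below_subset by (auto intro: permutes_swap_id)
  ultimately show ?thesis
    using Sub_subset_preserving subgroup.subset[OF Sub_subgroup] by blast
qed

end

end

text \<open>The sum in the criterion at \<open>t\<close> is
  \<open>card (points_below (m t))\<close>. If it is smaller than \<open>2^(m t)\<close> for some
  \<open>t\<close>, the subnormalizer preserves and splits along the long cycles; if it never is,
  all points are linked.\<close>

theorem theorem3p9:
  fixes n r :: nat and x :: "nat \<Rightarrow> nat" and m l :: "nat \<Rightarrow> nat"
  assumes "n > 0"
    and "\<not> (\<exists>e. n = 2 ^ e)"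
    and "x \<in> carrier (sym_group n)"
    and "\<exists>e. group.ord (sym_group n) x = 2 ^ e"
    and "strict_mono_on {1..r} m"
    and "card ` cycles_on x {1..n} = (\<lambda>i. 2 ^ m i) ` {1..r}"
    and "\<And>i. i \<in> {1..r} \<Longrightarrow> l i \<ge> 1"
    and "\<And>i. i \<in> {1..r} \<Longrightarrow> card {C \<in> cycles_on x {1..n}. card C = 2 ^ m i} = l i"
  shows "(subnormalizer (sym_group n) x \<subset> carrier (sym_group n) \<longleftrightarrow>
            (\<exists>t\<in>{2..r}. 2 ^ m t > (\<Sum>i = 1..t - 1. l i * 2 ^ m i))) \<and>
         (\<forall>t\<in>{2..r}. 2 ^ m t > (\<Sum>i = 1..t - 1. l i * 2 ^ m i) \<longrightarrow>
            (let k = (\<Sum>i = t..r. l i * 2 ^ m i);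
                 long = {C \<in> cycles_on x {1..n}. card C \<ge> 2 ^ m t};
                 short = {C \<in> cycles_on x {1..n}. card C < 2 ^ m t};
                 \<Omega> = \<Union> long;
                 y = cycle_product x long;
                 z = cycle_product x short
             in card \<Omega> = k \<and>
                subnormalizer (sym_group n) x =
                  subnormalizer (sym_group_on \<Omega>) y <#>\<^bsub>sym_group n\<^esub>
                  subnormalizer (sym_group_on ({1..n} - \<Omega>)) z))"
proof -
  define A where "A = {1..n}"
  have sym_eq: "sym_group n = sym_group_on A"
    unfolding A_def by (rule sym_group_on_atLeastAtMost[symmetric])
  have x: "x permutes A"
    using assms(3) by (simp add: sym_eq)
  have finite_A: "finite A"
    by (simp add: A_def)
  have "x ^^ group.ord (sym_group n) x = id"
    using group.pow_ord_eq_1[OF sym_group_is_group assms(3)] by (simp add: sym_eq)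
  then interpret two_element "A" x
    using x finite_A assms(4) by unfold_locales auto
  note sizes_eq = assms(6)[folded A_def] and l_eq = assms(8)[folded A_def]
  have sizes: "\<exists>i\<in>{1..r}. card C = 2 ^ m i" if "C \<in> \<C>" for C
    using imageI[OF that, of card] sizes_eq by auto
  have powers: "\<exists>e. card C = 2 ^ e" if "C \<in> \<C>" for C
    using sizes[OF that] by blast
  have m_less: "m i < m j \<longleftrightarrow> i < j" if "i \<in> {1..r}" "j \<in> {1..r}" for i j
    using that assms(5) by (metis linorder_neqE_nat order_less_asym strict_mono_onD)
  have inj: "inj_on m I" if "I \<subseteq> {1..r}" for I
    using that assms(5) strict_mono_on_imp_inj_on inj_on_subset by blast
  \<comment> \<open>By strict monotonicity of \<open>m\<close>, being shorter than
    \<open>2^(m t)\<close> means having index at most \<open>t - 1\<close>; for \<open>t = 1\<close>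
    the index range is empty.\<close>
  have short_sizes: "{C \<in> \<C>. card C < 2 ^ m t} = {C \<in> \<C>. \<exists>i\<in>{1..t - 1}. card C = 2 ^ m i}"
    if t: "t \<in> {1..r}" for t
  proof -
    have "card C < 2 ^ m t \<longleftrightarrow> (\<exists>i\<in>{1..t - 1}. card C = 2 ^ m i)" if C: "C \<in> \<C>" for C
    proof
      assume less: "card C < 2 ^ m t"
      obtain i where i: "i \<in> {1..r}" "card C = 2 ^ m i"
        using sizes[OF C] by blast
      then have "i < t"
        using less m_less[OF i(1) t] by simp
      then show "\<exists>i\<in>{1..t - 1}. card C = 2 ^ m i"
        using i by (intro bexI[of _ i]) auto
    next
      assume "\<exists>i\<in>{1..t - 1}. card C = 2 ^ m i"
      then obtain i where i: "i \<in> {1..t - 1}" "card C = 2 ^ m i"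
        by blast
      then have "m i < m t"
        using m_less[of i t] t by auto
      then show "card C < 2 ^ m t"
        using i by simp
    qed
    then show ?thesis
      by blast
  qed
  have card_below: "card (points_below (m t)) = (\<Sum>i = 1..t - 1. l i * 2 ^ m i)"
    if t: "t \<in> {1..r}" for t
  proof -
    have sub: "{1..t - 1} \<subseteq> {1..r}"
      using t by auto
    show ?thesis
      unfolding points_below_def short_sizes[OF t]
      by (rule card_Union_cycles_of_sizes[OF _ inj[OF sub] l_eq]) (use sub in auto)
  qed
  have small: "card (points_below (m t)) < 2 ^ m t"
    if "t \<in> {2..r}" "2 ^ m t > (\<Sum>i = 1..t - 1. l i * 2 ^ m i)" for t
    using card_below[of t] that by simp
  note product = Sub_eq_long_times_short[OF powers small]
  have proper: "Sub \<subset> carrier S"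
    if t: "t \<in> {2..r}" "2 ^ m t > (\<Sum>i = 1..t - 1. l i * 2 ^ m i)" for t
  proof -
    \<comment> \<open>As \<open>t \<ge> 2\<close>, a cycle of length \<open>2^(m 1)\<close> is
      short, while one of length \<open>2^(m t)\<close> is long.\<close>
    have "(2::nat) ^ m t \<in> card ` \<C>" "(2::nat) ^ m 1 \<in> card ` \<C>"
      using t(1) unfolding sizes_eq by auto
    then obtain C D where C: "C \<in> \<C>" "card C = 2 ^ m t" and D: "D \<in> \<C>" "card D = 2 ^ m 1"
      by (metis imageE)
    have "m 1 < m t"
      using m_less[of 1 t] t(1) by simp
    then show ?thesis
      using C D by (intro Sub_proper[OF powers small[OF t], of C D]) auto
  qed
  have ex_t: "\<exists>t\<in>{2..r}. 2 ^ m t > (\<Sum>i = 1..t - 1. l i * 2 ^ m i)" if "Sub \<subset> carrier S"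
  proof (rule ccontr)
    assume none: "\<not> ?thesis"
    have "Sub = carrier S"
    proof (rule Sub_eq_carrier_of_large_below[OF powers])
      \<comment> \<open>For \<open>t = 1\<close> there are no shorter cycles, and for
        \<open>t \<ge> 2\<close> the bound is the assumed failure of the criterion.\<close>
      show "2 ^ e \<le> card (points_below e)"
        if C: "C \<in> \<C>" "card C = 2 ^ e" and ne: "points_below e \<noteq> {}" for e C
      proof -
        obtain t where t: "t \<in> {1..r}" "e = m t"
          using sizes[OF C(1)] C(2) by auto
        have "t \<noteq> 1"
        proof
          assume "t = 1"
          then have "points_below e = {}"
            using short_sizes[OF t(1)] unfolding points_below_def t(2) by auto
          then show False
            using ne by simp
        qed
        then show ?thesis
          using none t card_below[OF t(1)] by (force simp: not_less)
      qed
      show "\<nexists>e. card A = 2 ^ e"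
        using assms(2) by (simp add: A_def)
    qed
    then show False
      using that by blast
  qed
  have card_long: "card (\<Union> {C \<in> \<C>. 2 ^ m t \<le> card C}) = (\<Sum>i = t..r. l i * 2 ^ m i)"
    if t: "t \<in> {2..r}" for t
  proof -
    have "2 ^ m t \<le> card C \<longleftrightarrow> (\<exists>i\<in>{t..r}. card C = 2 ^ m i)" if C: "C \<in> \<C>" for C
    proof
      assume le: "2 ^ m t \<le> card C"
      obtain i where i: "i \<in> {1..r}" "card C = 2 ^ m i"
        using sizes[OF C] by blast
      then have "t \<le> i"
        using le m_less[of i t] t by (simp add: not_less[symmetric])
      then show "\<exists>i\<in>{t..r}. card C = 2 ^ m i"
        using i by (intro bexI[of _ i]) auto
    next
      assume "\<exists>i\<in>{t..r}. card C = 2 ^ m i"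
      then obtain i where i: "i \<in> {t..r}" "card C = 2 ^ m i"
        by blast
      then have "m t \<le> m i"
        using m_less[of i t] t by (auto simp: not_less[symmetric])
      then show "2 ^ m t \<le> card C"
        using i by simp
    qed
    then have "{C \<in> \<C>. 2 ^ m t \<le> card C} = {C \<in> \<C>. \<exists>i\<in>{t..r}. card C = 2 ^ m i}"
      by blast
    moreover have sub: "{t..r} \<subseteq> {1..r}"
      using t by auto
    moreover have "card (\<Union> {C \<in> \<C>. \<exists>i\<in>{t..r}. card C = 2 ^ m i}) = (\<Sum>i = t..r. l i * 2 ^ m i)"
      by (rule card_Union_cycles_of_sizes[OF _ inj[OF sub] l_eq]) (use sub in auto)
    ultimately show ?thesis
      by simp
  qed
  have long_product: "cycle_product x {C \<in> \<C>. 2 ^ e \<le> card C} = perm_restrict x (A - points_below e)"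
    and short_product: "cycle_product x {C \<in> \<C>. card C < 2 ^ e} = perm_restrict x (points_below e)" for e
    using cycle_product_eq[OF x finite_A, of "{C \<in> \<C>. 2 ^ e \<le> card C}"]
      cycle_product_eq[OF x finite_A, of "{C \<in> \<C>. card C < 2 ^ e}"]
    unfolding Union_long_cycles by (auto simp: points_below_def)
  have compl: "A - (A - points_below e) = points_below e" for e
    using points_below_subset by blast
  show ?thesis
    unfolding sym_eq A_def[symmetric] Let_def long_product short_product Union_long_cycles compl
  proof (intro conjI ballI impI iffI)
    show "Sub \<subset> carrier S" if "\<exists>t\<in>{2..r}. 2 ^ m t > (\<Sum>i = 1..t - 1. l i * 2 ^ m i)"
      using that proper by blast
    show "card (A - points_below (m t)) = (\<Sum>i = t..r. l i * 2 ^ m i)" if "t \<in> {2..r}" for t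
      using card_long[OF that] unfolding Union_long_cycles .
  qed (use ex_t product in blast)+
qed

end
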